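(* Let $s,t\ge 1$ and let $k_1,\ldots,k_s$ and $l_1,\ldots,l_t$ be positive integers with $k_1+\cdots+k_s=l_1+\cdots+l_t$. Suppose the type $\Xi=\langle k_1,\ldots,k_s\,|\,l_1,\ldots,l_t\rangle$ is simple and non-decomposable. Then the cardinality of $\Xi$ is $|\Xi|=(s+t-2)!$.
   Context: A w-tree is a finite connected plane tree (embedded in the plane) in which every vertex and every edge carries a positive integer weight, such that the weight of each vertex equals the sum of the weights of the edges incident to it. The vertices of a tree are properly 2-colored, white and black (adjacent vertices have different colors). The type $\langle k_1,\ldots,k_s\,|\,l_1,\ldots,l_t\rangle$ (white weights $k_i$, black weights $l_j$, each list written in non-decreasing order, with $\sum k_i=\sum l_j$) is the set of w-trees having exactly $s$ white vertices with weights $k_1,\ldots,k_s$ and exactly $t$ black vertices with weights $l_1,\ldots,l_t$, considered up to orientation-preserving isotopy of the plane preserving colors and weights; $|\Xi|$ denotes the number of such pairwise non-isotopic w-trees. The type is simple if $k_1,\ldots,k_s$ are pairwise distinct and $l_1,\ldots,l_t$ are pairwise distinct. The type is decomposable if there exist a nonempty proper subset $I\subset\{1,\ldots,s\}$ and a nonempty proper subset $J\subset\{1,\ldots,t\}$ with $\sum_{i\in I}k_i=\sum_{j\in J}l_j$; otherwise it is non-decomposable. *)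

theory Defs
  imports "HOL-Combinatorics.Orbits" "HOL-Library.Multiset"
begin

text \<open>
  A finite tree embedded in the plane is represented by its rotation system: the abstract tree
  together with, at every vertex, the counterclockwise cyclic order of the edges leaving it.
  Two embedded trees are carried to each other by an orientation-preserving isotopy of the plane
  iff there is an isomorphism of the abstract trees that respects these cyclic orders, and every
  choice of cyclic orders on a finite tree arises from an embedding in the plane.

  Since the graph is simple, an edge leaving \<open>v\<close> is identified by its other end;
  \<open>rot T v u\<close> is the neighbour of \<open>v\<close> that follows the neighbour \<open>u\<close> counterclockwise around \<open>v\<close>.
  Every finite tree has a copy with vertices in \<^typ>\<open>nat\<close>, so this vertex type loses nothing.
  The values of the functions away from the vertices and edges of the tree are irrelevant; they
  are forgotten by the relation \<open>isotopic\<close> below.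
\<close>

record wtree =
  verts :: "nat set"
  edges :: "nat set set"
  rot :: "nat \<Rightarrow> nat \<Rightarrow> nat"
  white :: "nat \<Rightarrow> bool"
  vweight :: "nat \<Rightarrow> nat"
  eweight :: "nat set \<Rightarrow> nat"

definition adj :: "wtree \<Rightarrow> (nat \<times> nat) set" where
  "adj T = {(u, v). {u, v} \<in> edges T}"

definition nbrs :: "wtree \<Rightarrow> nat \<Rightarrow> nat set" where
  "nbrs T v = {u. {v, u} \<in> edges T}"

definition incident :: "wtree \<Rightarrow> nat \<Rightarrow> nat set set" where
  "incident T v = {e \<in> edges T. v \<in> e}"

definition is_simple_graph :: "wtree \<Rightarrow> bool" where
  "is_simple_graph T \<longleftrightarrow> finite (verts T) \<and> (\<forall>e \<in> edges T. e \<subseteq> verts T \<and> card e = 2)"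

definition is_connected :: "wtree \<Rightarrow> bool" where
  "is_connected T \<longleftrightarrow> verts T \<noteq> {} \<and> (\<forall>u \<in> verts T. \<forall>v \<in> verts T. (u, v) \<in> (adj T)\<^sup>*)"

definition is_cycle :: "wtree \<Rightarrow> nat list \<Rightarrow> bool" where
  "is_cycle T p \<longleftrightarrow> length p \<ge> 3 \<and> distinct p \<and>
     (\<forall>i < length p. {p ! i, p ! (Suc i mod length p)} \<in> edges T)"

definition is_tree :: "wtree \<Rightarrow> bool" where
  "is_tree T \<longleftrightarrow> is_simple_graph T \<and> is_connected T \<and> (\<nexists>p. is_cycle T p)"

text \<open>
  The condition \<^prop>\<open>nbrs T v \<noteq> {}\<close> only concerns the one-vertex tree:
  \<^prop>\<open>cyclic_on f {}\<close> is false.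
\<close>

definition is_plane_tree :: "wtree \<Rightarrow> bool" where
  "is_plane_tree T \<longleftrightarrow> is_tree T \<and>
     (\<forall>v \<in> verts T. nbrs T v \<noteq> {} \<longrightarrow> cyclic_on (rot T v) (nbrs T v))"

definition properly_colored :: "wtree \<Rightarrow> bool" where
  "properly_colored T \<longleftrightarrow> (\<forall>u v. {u, v} \<in> edges T \<longrightarrow> white T u \<noteq> white T v)"

definition is_wtree :: "wtree \<Rightarrow> bool" where
  "is_wtree T \<longleftrightarrow> is_plane_tree T \<and> properly_colored T \<and>
     (\<forall>v \<in> verts T. vweight T v > 0) \<and>
     (\<forall>e \<in> edges T. eweight T e > 0) \<and>
     (\<forall>v \<in> verts T. vweight T v = (\<Sum>e \<in> incident T v. eweight T e))"

definition plane_iso :: "wtree \<Rightarrow> wtree \<Rightarrow> (nat \<Rightarrow> nat) \<Rightarrow> bool" where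
  "plane_iso T T' f \<longleftrightarrow> bij_betw f (verts T) (verts T') \<and>
     edges T' = (\<lambda>e. f ` e) ` edges T \<and>
     (\<forall>v \<in> verts T. \<forall>u \<in> nbrs T v. rot T' (f v) (f u) = f (rot T v u)) \<and>
     (\<forall>v \<in> verts T. white T' (f v) = white T v) \<and>
     (\<forall>v \<in> verts T. vweight T' (f v) = vweight T v) \<and>
     (\<forall>e \<in> edges T. eweight T' (f ` e) = eweight T e)"

definition isotopic :: "wtree \<Rightarrow> wtree \<Rightarrow> bool" where
  "isotopic T T' \<longleftrightarrow> (\<exists>f. plane_iso T T' f)"

text \<open>
  The parameters are \<open>k 1, \<dots>, k s\<close> (white) and \<open>l 1, \<dots>, l t\<close> (black). The lists of weights
  are compared as multisets, so the order in which \<open>k\<close> and \<open>l\<close> enumerate them does not matter.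
\<close>

definition wtrees_with :: "nat \<Rightarrow> (nat \<Rightarrow> nat) \<Rightarrow> nat \<Rightarrow> (nat \<Rightarrow> nat) \<Rightarrow> wtree set" where
  "wtrees_with s k t l = {T. is_wtree T \<and>
     image_mset (vweight T) (mset_set {v \<in> verts T. white T v}) = image_mset k (mset_set {1..s}) \<and>
     image_mset (vweight T) (mset_set {v \<in> verts T. \<not> white T v}) = image_mset l (mset_set {1..t})}"

definition isotopy_rel :: "wtree set \<Rightarrow> (wtree \<times> wtree) set" where
  "isotopy_rel A = {(T, T'). T \<in> A \<and> T' \<in> A \<and> isotopic T T'}"

definition wtype :: "nat \<Rightarrow> (nat \<Rightarrow> nat) \<Rightarrow> nat \<Rightarrow> (nat \<Rightarrow> nat) \<Rightarrow> wtree set set" where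
  "wtype s k t l = wtrees_with s k t l // isotopy_rel (wtrees_with s k t l)"

definition simple_type :: "nat \<Rightarrow> (nat \<Rightarrow> nat) \<Rightarrow> nat \<Rightarrow> (nat \<Rightarrow> nat) \<Rightarrow> bool" where
  "simple_type s k t l \<longleftrightarrow> inj_on k {1..s} \<and> inj_on l {1..t}"

definition decomposable_type :: "nat \<Rightarrow> (nat \<Rightarrow> nat) \<Rightarrow> nat \<Rightarrow> (nat \<Rightarrow> nat) \<Rightarrow> bool" where
  "decomposable_type s k t l \<longleftrightarrow>
     (\<exists>I J. I \<noteq> {} \<and> I \<subset> {1..s} \<and> J \<noteq> {} \<and> J \<subset> {1..t} \<and> (\<Sum>i\<in>I. k i) = (\<Sum>j\<in>J. l j))"

lemma isotopic_refl: "isotopic T T"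
  unfolding isotopic_def plane_iso_def by (rule exI[of _ id]) simp

lemma nbrs_subset: "is_wtree T \<Longrightarrow> nbrs T v \<subseteq> verts T"
  by (auto simp: is_wtree_def is_plane_tree_def is_tree_def is_simple_graph_def nbrs_def)

lemma rot_in_nbrs: "is_wtree T \<Longrightarrow> v \<in> verts T \<Longrightarrow> u \<in> nbrs T v \<Longrightarrow> rot T v u \<in> nbrs T v"
  unfolding is_wtree_def is_plane_tree_def by (metis cyclic_on_inI empty_iff)

lemma isotopic_nbrs:
  assumes "is_wtree T" "is_wtree T'" "bij_betw f (verts T) (verts T')"
    and E: "edges T' = (\<lambda>e. f ` e) ` edges T" and v: "v \<in> verts T"
  shows "nbrs T' (f v) = f ` nbrs T v"
proof
  have sub: "e \<subseteq> verts T \<and> card e = 2" if "e \<in> edges T" for e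
    using assms(1) that
    by (auto simp: is_wtree_def is_plane_tree_def is_tree_def is_simple_graph_def)
  have inj: "inj_on f (verts T)" using assms(3) by (rule bij_betw_imp_inj_on)
  show "f ` nbrs T v \<subseteq> nbrs T' (f v)"
  proof
    fix w assume "w \<in> f ` nbrs T v"
    then obtain u where u: "{v, u} \<in> edges T" "w = f u" by (auto simp: nbrs_def)
    have "f ` {v, u} \<in> edges T'" unfolding E using u(1) by (rule imageI)
    then show "w \<in> nbrs T' (f v)" using u(2) by (simp add: nbrs_def)
  qed
  show "nbrs T' (f v) \<subseteq> f ` nbrs T v"
  proof
    fix w assume "w \<in> nbrs T' (f v)"
    then obtain e where e: "e \<in> edges T" "{f v, w} = f ` e"
      unfolding nbrs_def E by blast
    obtain a b where ab: "e = {a, b}" using sub[OF e(1)] by (auto simp: card_2_iff)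
    have "f v \<in> f ` e" using e(2) by blast
    then have "v \<in> e"
      using sub[OF e(1)] v inj_on_image_mem_iff[OF inj, of v e] by simp
    then obtain c where c: "e = {v, c}" using ab by auto
    have "c \<noteq> v" using sub[OF e(1)] c by auto
    moreover have "c \<in> verts T" using sub[OF e(1)] c by auto
    ultimately have "f c \<noteq> f v" using inj v by (auto simp: inj_on_def)
    then have "w = f c" using e(2) unfolding c by (simp add: doubleton_eq_iff)
    then show "w \<in> f ` nbrs T v" using c e(1) by (simp add: nbrs_def)
  qed
qed

lemma isotopic_sym:
  assumes T: "is_wtree T" and T': "is_wtree T'" and iso: "isotopic T T'"
  shows "isotopic T' T"
proof -
  from iso obtain f where hf: "plane_iso T T' f" unfolding isotopic_def ..
  then have f: "bij_betw f (verts T) (verts T')"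
    and E: "edges T' = (\<lambda>e. f ` e) ` edges T"
    and R: "\<And>v u. v \<in> verts T \<Longrightarrow> u \<in> nbrs T v \<Longrightarrow> rot T' (f v) (f u) = f (rot T v u)"
    and C: "\<And>v. v \<in> verts T \<Longrightarrow> white T' (f v) = white T v"
    and W: "\<And>v. v \<in> verts T \<Longrightarrow> vweight T' (f v) = vweight T v"
    and W': "\<And>e. e \<in> edges T \<Longrightarrow> eweight T' (f ` e) = eweight T e"
    by (simp_all add: plane_iso_def)
  define g where "g = the_inv_into (verts T) f"
  have inj: "inj_on f (verts T)" using f by (rule bij_betw_imp_inj_on)
  have g: "bij_betw g (verts T') (verts T)"
    unfolding g_def using f by (rule bij_betw_the_inv_into)
  have gf: "g (f v) = v" if "v \<in> verts T" for v
    unfolding g_def using inj that by (rule the_inv_into_f_f)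
  have sub: "e \<subseteq> verts T" if "e \<in> edges T" for e
    using T that by (auto simp: is_wtree_def is_plane_tree_def is_tree_def is_simple_graph_def)
  have gfe: "g ` f ` e = e" if "e \<in> edges T" for e
    using sub[OF that] gf by (simp add: image_image subset_iff)
  have V: "verts T' = f ` verts T" using f by (simp add: bij_betw_imp_surj_on)
  have "(\<lambda>e. g ` e) ` edges T' = (\<lambda>e. g ` f ` e) ` edges T"
    unfolding E by (rule image_image)
  also have "\<dots> = (\<lambda>e. e) ` edges T"
    by (rule image_cong[OF refl]) (rule gfe)
  finally have "edges T = (\<lambda>e. g ` e) ` edges T'" by simp
  moreover have "rot T (g v) (g u) = g (rot T' v u)" if v: "v \<in> verts T'" and u: "u \<in> nbrs T' v" for v u
  proof -
    obtain v0 where v0: "v0 \<in> verts T" "v = f v0" using v V by auto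
    obtain u0 where u0: "u0 \<in> nbrs T v0" "u = f u0"
      using u isotopic_nbrs[OF T T' f E v0(1)] v0(2) by auto
    have "rot T v0 u0 \<in> verts T" "u0 \<in> verts T"
      using rot_in_nbrs[OF T v0(1) u0(1)] u0(1) nbrs_subset[OF T] by auto
    then show ?thesis using R[OF v0(1) u0(1)] v0 u0 gf by simp
  qed
  ultimately show ?thesis
    unfolding isotopic_def plane_iso_def
    by (intro exI[of _ g] conjI g) (auto simp: V E gf gfe C W W')
qed

lemma isotopic_trans:
  assumes T: "is_wtree T" "is_wtree T'" and "isotopic T T'" "isotopic T' T''"
  shows "isotopic T T''"
proof -
  from assms(3) obtain f where hf: "plane_iso T T' f" unfolding isotopic_def ..
  then have f: "bij_betw f (verts T) (verts T')"
    and E: "edges T' = (\<lambda>e. f ` e) ` edges T"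
    and R: "\<And>v u. v \<in> verts T \<Longrightarrow> u \<in> nbrs T v \<Longrightarrow> rot T' (f v) (f u) = f (rot T v u)"
    and C: "\<And>v. v \<in> verts T \<Longrightarrow> white T' (f v) = white T v"
    and W: "\<And>v. v \<in> verts T \<Longrightarrow> vweight T' (f v) = vweight T v"
    and W': "\<And>e. e \<in> edges T \<Longrightarrow> eweight T' (f ` e) = eweight T e"
    by (simp_all add: plane_iso_def)
  from assms(4) obtain g where hg: "plane_iso T' T'' g" unfolding isotopic_def ..
  then have g: "bij_betw g (verts T') (verts T'')"
    and gE: "edges T'' = (\<lambda>e. g ` e) ` edges T'"
    and gR: "\<And>v u. v \<in> verts T' \<Longrightarrow> u \<in> nbrs T' v \<Longrightarrow> rot T'' (g v) (g u) = g (rot T' v u)"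
    and gC: "\<And>v. v \<in> verts T' \<Longrightarrow> white T'' (g v) = white T' v"
    and gW: "\<And>v. v \<in> verts T' \<Longrightarrow> vweight T'' (g v) = vweight T' v"
    and gW': "\<And>e. e \<in> edges T' \<Longrightarrow> eweight T'' (g ` e) = eweight T' e"
    by (simp_all add: plane_iso_def)
  have fv: "f v \<in> verts T'" if "v \<in> verts T" for v using f that by (rule bij_betw_apply)
  have fe: "f ` e \<in> edges T'" if "e \<in> edges T" for e using E that by blast
  have fn: "f u \<in> nbrs T' (f v)" if "v \<in> verts T" "u \<in> nbrs T v" for u v
    using isotopic_nbrs[OF T f E that(1)] that(2) by blast
  have "bij_betw (g \<circ> f) (verts T) (verts T'')" using f g by (rule bij_betw_trans)
  moreover have "edges T'' = (\<lambda>e. (g \<circ> f) ` e) ` edges T"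
    by (simp add: gE E image_image image_comp)
  moreover have "eweight T'' ((g \<circ> f) ` e) = eweight T e" if "e \<in> edges T" for e
    using gW'[OF fe[OF that]] W'[OF that] by (simp add: image_comp)
  ultimately show ?thesis
    unfolding isotopic_def plane_iso_def
    by (intro exI[of _ "g \<circ> f"] conjI ballI) (simp_all add: fv fn gR R gC C gW W)
qed

lemma equiv_isotopy_rel:
  assumes "\<And>T. T \<in> A \<Longrightarrow> is_wtree T"
  shows "equiv A (isotopy_rel A)"
proof (rule equivI)
  show "isotopy_rel A \<subseteq> A \<times> A" "refl_on A (isotopy_rel A)"
    by (auto simp: isotopy_rel_def refl_on_def isotopic_refl)
  show "sym (isotopy_rel A)"
    using assms isotopic_sym by (auto simp: isotopy_rel_def intro!: symI)
  show "trans (isotopy_rel A)"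
    unfolding isotopy_rel_def trans_def using assms isotopic_trans by blast
qed

end

theory Submission
  imports Defs "HOL-Library.Nat_Bijection"
begin

text \<open>
  Identify each vertex with its signed weight: the weight of a white vertex, minus the weight of
  a black one. Cutting a tree at one of its \<open>n - 1\<close> edges, where \<open>n = s + t\<close>, gives two planted
  rose trees, and reading them with white vertices in preorder and black vertices in postorder
  gives a linear order of the \<open>n\<close> signed weights.
  Positivity of the edge weights says that every proper nonempty initial segment has positive
  sum. Conversely, such an order is parsed uniquely, like a bracket expression: each black
  vertex absorbs the pending white trees until its weight is exhausted, and hangs on the tree at
  which this happens. Non-decomposability rules out ties. It also gives, by the cycle lemma, that
  every cyclic order of the signed weights can be cut in exactly one way into such a linear
  order, so there are \<open>(n - 1)!\<close> trees with a distinguished edge. As the vertices are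
  distinguishable, these are \<open>n - 1\<close> times as many as trees.
\<close>

subsection \<open>Rose trees and their words\<close>

text \<open>Edge weights are not extra data. In the sum of the signed weights behind an edge every
  other edge weight cancels, because the two ends of an edge have opposite signs; what remains is
  plus or minus the weight of the edge that was cut. A w-tree of simple type is therefore a plane
  tree with distinct signed weights at its vertices for which each such sum has the sign of the
  vertex just behind the edge; this is what \<open>good\<close> says. The parser keeps a stack of
  trees with white roots. The sum of the letters read so far is the total \<open>tsum\<close> of the
  stack, so a positive prefix sum says exactly that a black letter finds more pending weight than it
  needs, hence a tree to hang on. Only the last letter differs: the total is zero, so it takes
  everything above the bottom tree \<open>A\<close> and becomes the root of \<open>B\<close>; the
  distinguished edge joins the two roots.\<close>

datatype 'a rtree = Node (root: 'a) (kids: "'a rtree list")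

primrec labels :: "'a rtree \<Rightarrow> 'a list" where
  "labels (Node v ts) = v # concat (map labels ts)"

primrec word :: "int rtree \<Rightarrow> int list" where
  "word (Node v ts) = (if v > 0 then v # concat (map word ts) else concat (map word ts) @ [v])"

definition tsum :: "int rtree \<Rightarrow> int" where
  "tsum t = sum_list (labels t)"

text \<open>In the tree of a w-tree, \<open>tsum\<close> is the weight of the edge above the root,
  with the sign of the root's colour. The last condition is thus positivity of that edge weight, and
  the sign condition on the children is the proper colouring.\<close>

fun good :: "int rtree \<Rightarrow> bool" where
  "good (Node v ts) \<longleftrightarrow> (\<forall>t \<in> set ts. root t * v < 0 \<and> good t) \<and> v * tsum (Node v ts) > 0"

text \<open>The states of the parser: stacks of pending trees, with the top at the right
  end.\<close>

definition good_forest :: "int rtree list \<Rightarrow> bool" where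
  "good_forest ts \<longleftrightarrow> (\<forall>t \<in> set ts. good t \<and> root t > 0)"

abbreviation forest_word :: "int rtree list \<Rightarrow> int list" where
  "forest_word ts \<equiv> concat (map word ts)"

lemma set_labels [simp]: "set (labels t) = set_rtree t"
  by (induction t) auto

lemma root_in_set [simp]: "root t \<in> set_rtree t"
  by (cases t) simp

lemma root_map [simp]: "root (map_rtree f t) = f (root t)"
  by (cases t) simp

lemma kids_map [simp]: "kids (map_rtree f t) = map (map_rtree f) (kids t)"
  by (cases t) simp

lemma labels_map: "labels (map_rtree f t) = map f (labels t)"
  by (induction t) (simp add: map_concat comp_def cong: map_cong)

lemma mset_word [simp]: "mset (word t) = mset (labels t)"
proof (induction t)
  case (Node v ts)
  then have "mset (concat (map word ts)) = mset (concat (map labels ts))"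
    by (induction ts) auto
  then show ?case by simp
qed

lemma set_word [simp]: "set (word t) = set_rtree t"
  by (metis mset_word set_labels set_mset_mset)

lemma distinct_word [simp]: "distinct (word t) \<longleftrightarrow> distinct (labels t)"
  by (metis mset_word mset_eq_imp_distinct_iff)

lemma sum_list_concat: "sum_list (concat xss) = sum_list (map sum_list (xss :: 'a::monoid_add list list))"
  by (induction xss) auto

lemma tsum_Node: "tsum (Node v ts) = v + sum_list (map tsum ts)"
  by (simp add: tsum_def[abs_def] comp_def sum_list_concat)

lemma sum_list_word: "sum_list (word t) = tsum t"
  by (metis mset_word sum_mset_sum_list tsum_def)

lemma sum_forest_word: "sum_list (forest_word ts) = sum_list (map tsum ts)"
  by (simp add: sum_list_concat comp_def sum_list_word)

lemma word_ne [simp]: "word t \<noteq> []"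
  by (cases t) simp

lemma good_tsum_pos: "good t \<Longrightarrow> root t > 0 \<Longrightarrow> tsum t > 0"
  by (cases t) (simp add: zero_less_mult_iff)

lemma good_tsum_neg: "good t \<Longrightarrow> root t < 0 \<Longrightarrow> tsum t < 0"
  by (cases t) (simp add: zero_less_mult_iff)

lemma good_forest_sum_nonneg: "good_forest ts \<Longrightarrow> sum_list (map tsum ts) \<ge> 0"
  unfolding good_forest_def
  by (induction ts) (auto dest: good_tsum_pos)

lemma good_forest_append [simp]: "good_forest (ts @ us) \<longleftrightarrow> good_forest ts \<and> good_forest us"
  by (auto simp: good_forest_def)

lemma good_forest_Cons [simp]: "good_forest (t # us) \<longleftrightarrow> good t \<and> root t > 0 \<and> good_forest us"
  by (auto simp: good_forest_def)

lemma good_forest_Nil [simp]: "good_forest []"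
  by (auto simp: good_forest_def)

lemma word_snoc_neg: "word t = w @ [c] \<Longrightarrow> root t < 0 \<Longrightarrow> \<exists>ds. t = Node c ds \<and> w = forest_word ds"
  by (cases t) auto

text \<open>The last step of the parser, undone.\<close>

lemma good_forest_snoc:
  assumes gf: "good_forest ts" and w: "forest_word ts = w @ [c]"
  obtains us where "c > 0" "ts = us @ [Node c []]" "good_forest us" "forest_word us = w"
  | us d cs ds where "c < 0" "ts = us @ [Node d (cs @ [Node c ds])]"
      "good_forest (us @ Node d cs # ds)" "forest_word (us @ Node d cs # ds) = w"
      "sum_list (map tsum ds) + c < 0" "tsum (Node d cs) + sum_list (map tsum ds) + c > 0"
proof -
  have "ts \<noteq> []" using w by auto
  then obtain us t where ts: "ts = us @ [t]" by (metis rev_exhaust)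
  obtain d ks where t: "t = Node d ks" by (cases t)
  have d: "d > 0" and gt: "good (Node d ks)" and gu: "good_forest us"
    using gf unfolding ts t by auto
  show ?thesis
  proof (cases ks rule: rev_exhaust)
    case Nil
    then show ?thesis using that(1)[of us] d gu w unfolding ts t by simp
  next
    case (snoc cs b)
    have b: "good b" "root b < 0" using gt d snoc by (auto simp: mult_less_0_iff)
    \<comment> \<open>The last child \<open>b\<close> is black, so its root is read after all its
      descendants and is the last letter of the whole word.\<close>
    obtain x y where xy: "word b = x @ [y]" by (metis rev_exhaust word_ne)
    then have "y = c" using w d unfolding ts t snoc by simp
    then obtain ds where ds: "b = Node c ds" "x = forest_word ds"
      using word_snoc_neg[OF xy b(2)] by auto
    have c: "c < 0" using b ds by simp
    have gds: "good_forest ds" using b(1) c unfolding ds good_forest_def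
      by (auto simp: mult_less_0_iff)
    have s1: "sum_list (map tsum ds) + c < 0"
      using good_tsum_neg[OF b] unfolding ds tsum_Node by simp
    have s2: "tsum (Node d cs) + sum_list (map tsum ds) + c > 0"
      using good_tsum_pos[OF gt] d unfolding snoc ds by (simp add: tsum_Node)
    \<comment> \<open>Removing the black child raises the sum: \<open>s1\<close> and
      \<open>s2\<close> together give \<open>tsum (Node d cs) > 0\<close>.\<close>
    have "good (Node d cs)"
      using gt d s1 s2 unfolding snoc by (auto simp: zero_less_mult_iff)
    then show ?thesis
      using that(2)[of us d cs ds] c s1 s2 gds gu d w xy ds unfolding ts t snoc by simp
  qed
qed

text \<open>Undoing one parser step deletes the last letter and leaves a good forest. So each prefix
  is itself the word of a good forest, and its sum is a sum of positive values of
  \<open>tsum\<close>.\<close>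

lemma good_forest_prefix_sum:
  assumes "good_forest ts" "forest_word ts = xs @ ys" "xs \<noteq> []"
  shows "sum_list xs > 0"
  using assms
proof (induction ys arbitrary: ts rule: rev_induct)
  case Nil
  then have "ts \<noteq> []" "sum_list xs = sum_list (map tsum ts)"
    by (auto simp flip: sum_forest_word)
  with Nil.prems(1) show ?case
    using good_tsum_pos good_forest_sum_nonneg by (cases ts) (auto simp: add_pos_nonneg)
next
  case (snoc c ys)
  from snoc.prems have eq: "forest_word ts = (xs @ ys) @ [c]" by simp
  from snoc.prems(1) eq show ?case
  proof (cases rule: good_forest_snoc)
    case (1 us)
    then show ?thesis using snoc.IH snoc.prems by blast
  next
    case (2 us d cs ds)
    then show ?thesis using snoc.IH snoc.prems by blast
  qed
qed

text \<open>With positive values the tail sums strictly grow with the tail, so they cross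
  \<open>z\<close> at one place only. Here \<open>z\<close> will be the weight of a black vertex and
  \<open>ds\<close> the trees it absorbs.\<close>

lemma split_at_threshold_unique:
  assumes "us @ t # ds = us' @ t' # ds'" and pos: "\<forall>x \<in> set (us @ t # ds). f x > (0::int)"
    and "sum_list (map f ds) < z" "f t + sum_list (map f ds) > z"
    and "sum_list (map f ds') < z" "f t' + sum_list (map f ds') > z"
  shows "us = us' \<and> t = t' \<and> ds = ds'"
proof -
  have nn: "sum_list (map f zs) \<ge> 0" if "set zs \<subseteq> set (us @ t # ds)" for zs
    using that pos by (intro sum_list_nonneg) force
  consider "us = us'" | zs where "us = us' @ t' # zs" "ds' = zs @ t # ds"
    | zs where "us' = us @ t # zs" "ds = zs @ t' # ds'"
    using assms(1) by (auto simp: append_eq_append_conv2 append_eq_Cons_conv Cons_eq_append_conv)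
  then show ?thesis
  proof cases
    case 1
    then show ?thesis using assms(1) by simp
  next
    case 2
    then have "sum_list (map f zs) \<ge> 0" by (intro nn) auto
    then show ?thesis using 2 assms by simp
  next
    case 3
    then have "sum_list (map f zs) \<ge> 0" by (intro nn) auto
    then show ?thesis using 3 assms by simp
  qed
qed

text \<open>The sign of the last letter tells which parser step came last. The stacks before that
  step agree by induction, and for a black letter the threshold fixes where the stack was
  cut.\<close>

lemma forest_word_inj:
  assumes "good_forest ts" "good_forest us" "forest_word ts = forest_word us"
  shows "ts = us"
  using assms
proof (induction "forest_word ts" arbitrary: ts us rule: rev_induct)
  case Nil
  then show ?case by (cases ts; cases us) auto
next
  case (snoc c w)
  have wt: "forest_word ts = w @ [c]" and wu: "forest_word us = w @ [c]"
    using snoc.hyps snoc.prems by auto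
  from snoc.prems(1) wt show ?case
  proof (cases rule: good_forest_snoc)
    case t: (1 ts')
    from snoc.prems(2) wu show ?thesis
    proof (cases rule: good_forest_snoc)
      case (1 us')
      then have "ts' = us'" using snoc.hyps(1) t by metis
      then show ?thesis using 1 t by simp
    qed (use t in simp)
  next
    case t: (2 ts' d cs ds)
    from snoc.prems(2) wu show ?thesis
    proof (cases rule: good_forest_snoc)
      case (2 us' d' cs' ds')
      have "ts' @ Node d cs # ds = us' @ Node d' cs' # ds'"
        using snoc.hyps(1)[OF t(4)[symmetric] t(3) 2(3)] 2(4) t(4) by simp
      moreover have "\<forall>x \<in> set (ts' @ Node d cs # ds). tsum x > 0"
        using t(3) good_tsum_pos unfolding good_forest_def by blast
      ultimately have "ts' = us' \<and> Node d cs = Node d' cs' \<and> ds = ds'"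
        by (rule split_at_threshold_unique[where z = "-c"]) (use t 2 in auto)
      then show ?thesis using 2 t by simp
    qed (use t in simp)
  qed
qed

text \<open>The bound on \<open>ds\<close> is weak: a tie is possible at this level of generality,
  and it is excluded where the lemma is applied.\<close>

lemma split_at_threshold:
  assumes "sum_list (map f ts) > z" "(z::int) \<ge> 0"
  shows "\<exists>us t ds. ts = us @ t # ds \<and> sum_list (map f ds) \<le> z \<and> f t + sum_list (map f ds) > z"
  using assms
proof (induction ts)
  case (Cons t ts)
  show ?case
  proof (cases "sum_list (map f ts) > z")
    case True
    with Cons obtain us t' ds where "ts = us @ t' # ds" "sum_list (map f ds) \<le> z"
      "f t' + sum_list (map f ds) > z" by blast
    then show ?thesis by (intro exI[of _ "t # us"] exI[of _ t'] exI[of _ ds]) simp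
  next
    case False
    then show ?thesis using Cons.prems by (intro exI[of _ "[]"] exI[of _ t] exI[of _ ts]) simp
  qed
qed simp

text \<open>This is a run of the parser. Positive prefix sums guarantee that the stack outweighs
  each black letter; nonzero segment sums exclude a black letter that is exhausted exactly between
  two trees.\<close>

lemma forest_word_surj:
  assumes "\<And>as bs. xs = as @ bs \<Longrightarrow> as \<noteq> [] \<Longrightarrow> sum_list as > 0"
    and "\<And>as bs cs. xs = as @ bs @ cs \<Longrightarrow> bs \<noteq> [] \<Longrightarrow> sum_list bs \<noteq> 0"
  shows "\<exists>ts. good_forest ts \<and> forest_word ts = xs"
  using assms
proof (induction xs rule: rev_induct)
  case Nil
  then show ?case by (intro exI[of _ "[]"]) simp
next
  case (snoc c w)
  have "\<exists>ts. good_forest ts \<and> forest_word ts = w"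
  proof (rule snoc.IH)
    show "sum_list as > 0" if "w = as @ bs" "as \<noteq> []" for as bs
      using snoc.prems(1)[of as "bs @ [c]"] that by simp
    show "sum_list bs \<noteq> 0" if "w = as @ bs @ cs" "bs \<noteq> []" for as bs cs
      using snoc.prems(2)[of as bs "cs @ [c]"] that by simp
  qed
  then obtain ts where ts: "good_forest ts" "forest_word ts = w" by blast
  have "c \<noteq> 0" using snoc.prems(2)[of w "[c]" "[]"] by simp
  then consider "c > 0" | "c < 0" by linarith
  then show ?case
  proof cases
    case 1
    then show ?thesis using ts by (intro exI[of _ "ts @ [Node c []]"]) (simp add: tsum_Node)
  next
    case 2
    have "sum_list (map tsum ts) > - c"
      using snoc.prems(1)[of "w @ [c]" "[]"] ts(2) by (simp add: sum_forest_word[symmetric])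
    then obtain us t ds where sp: "ts = us @ t # ds" "sum_list (map tsum ds) \<le> - c"
      "tsum t + sum_list (map tsum ds) > - c"
      using split_at_threshold[of "- c" tsum ts] 2 by auto
    obtain d cs where t: "t = Node d cs" by (cases t)
    \<comment> \<open>In a tie the absorbed trees followed by \<open>c\<close> would be a segment of
      the word with sum zero.\<close>
    have "sum_list (forest_word ds @ [c]) \<noteq> 0"
      using snoc.prems(2)[of "forest_word us @ word t" "forest_word ds @ [c]" "[]"] ts(2) sp(1) by simp
    then have neg: "sum_list (map tsum ds) + c < 0"
      using sp(2) by (simp add: sum_forest_word)
    have g: "good (Node d cs)" "d > 0" "good_forest ds" "good_forest us"
      using ts(1) unfolding sp(1) t by auto
    have gc: "good (Node c ds)"
      using 2 neg g(3) by (auto simp: tsum_Node good_forest_def mult_pos_neg intro: mult_neg_neg)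
    have "good (Node d (cs @ [Node c ds]))"
      using g gc 2 sp(3) unfolding t by (auto simp: tsum_Node mult_neg_pos)
    then show ?thesis
      using g 2 ts(2) unfolding sp(1) t
      by (intro exI[of _ "us @ [Node d (cs @ [Node c ds])]"]) auto
  qed
qed

section \<open>Pairs of planted trees, and their number by the cycle lemma\<close>

definition good_pairs :: "int set \<Rightarrow> (int rtree \<times> int rtree) set" where
  "good_pairs V = {(A, B). good A \<and> root A > 0 \<and> good B \<and> root B < 0 \<and>
     distinct (labels A @ labels B) \<and> set_rtree A \<union> set_rtree B = V}"

definition positive_orders :: "int set \<Rightarrow> int list set" where
  "positive_orders V = {xs. distinct xs \<and> set xs = V \<and>
     (\<forall>i. 0 < i \<and> i < length xs \<longrightarrow> sum_list (take i xs) > 0)}"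

text \<open>Non-decomposability in terms of signed weights: a vanishing subset sum is an equality
  between a sum of white weights and a sum of black weights.\<close>

definition nonresonant :: "int set \<Rightarrow> bool" where
  "nonresonant V \<longleftrightarrow> finite V \<and> \<Sum>V = 0 \<and> (\<forall>U. U \<subset> V \<longrightarrow> U \<noteq> {} \<longrightarrow> \<Sum>U \<noteq> 0)"

text \<open>The root of \<open>B\<close> is black, hence the last letter. Deleting it leaves the
  word of the good forest formed by \<open>A\<close> and the children of that root, so the pair
  corresponds to a parser stack whose bottom tree is \<open>A\<close>.\<close>

lemma good_pairs_bij:
  assumes V: "nonresonant V" and "card V \<ge> 2"
  shows "bij_betw (\<lambda>(A, B). word A @ word B) (good_pairs V) (positive_orders V)"
proof (rule bij_betwI')
  fix p q assume "p \<in> good_pairs V" "q \<in> good_pairs V"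
  moreover obtain A c ds where p: "p = (A, Node c ds)" by (metis rtree.exhaust surj_pair)
  moreover obtain A' c' ds' where q: "q = (A', Node c' ds')" by (metis rtree.exhaust surj_pair)
  ultimately have gf: "good_forest (A # ds)" "good_forest (A' # ds')" "c < 0" "c' < 0"
    unfolding good_pairs_def good_forest_def by (auto simp: mult_less_0_iff)
  have "p = q" if "(\<lambda>(A, B). word A @ word B) p = (\<lambda>(A, B). word A @ word B) q"
  proof -
    have "forest_word (A # ds) = forest_word (A' # ds')" "c = c'"
      using that gf unfolding p q by auto
    then show ?thesis using forest_word_inj[OF gf(1,2)] unfolding p q by simp
  qed
  then show "((\<lambda>(A, B). word A @ word B) p = (\<lambda>(A, B). word A @ word B) q) = (p = q)" by blast
next
  fix p assume pQ: "p \<in> good_pairs V"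
  obtain A c ds where p: "p = (A, Node c ds)" by (metis rtree.exhaust surj_pair)
  have gf: "good_forest (A # ds)" "c < 0"
    using pQ unfolding p good_pairs_def good_forest_def by (auto simp: mult_less_0_iff)
  have "sum_list (take i (forest_word (A # ds) @ [c])) > 0"
    if "0 < i" "i < length (forest_word (A # ds) @ [c])" for i
    using that good_forest_prefix_sum[OF gf(1), of "take i (forest_word (A # ds))"
        "drop i (forest_word (A # ds))"]
    by (simp del: concat.simps list.map)
  then show "(\<lambda>(A, B). word A @ word B) p \<in> positive_orders V"
    using pQ gf(2) mset_word[of "Node c ds"] set_word[of "Node c ds"] distinct_word[of "Node c ds"]
    unfolding p good_pairs_def positive_orders_def
    by (auto simp del: mset_word set_word distinct_word word.simps labels.simps rtree.set) (auto)
next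
  fix xs assume xs: "xs \<in> positive_orders V"
  have fin: "distinct xs" "set xs = V" using xs by (auto simp: positive_orders_def)
  have len: "length xs \<ge> 2" using fin assms(2) by (metis distinct_card)
  then obtain w c where wc: "xs = w @ [c]" by (metis rev_exhaust list.size(3) not_numeral_le_zero)
  have wne: "w \<noteq> []" using len wc by auto
  have tot: "sum_list xs = 0" using fin V by (simp add: nonresonant_def distinct_sum_list_conv_Sum)
  have pre: "sum_list as > 0" if "w = as @ bs" "as \<noteq> []" for as bs
  proof -
    have "\<forall>i. 0 < i \<and> i < length xs \<longrightarrow> sum_list (take i xs) > 0"
      using xs by (simp add: positive_orders_def)
    from this[rule_format, of "length as"] show ?thesis using that wc by simp
  qed
  have nz: "sum_list bs \<noteq> 0" if "w = as @ bs @ cs" "bs \<noteq> []" for as bs cs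
  proof -
    \<comment> \<open>Since \<open>c\<close> lies outside \<open>bs\<close>, the letters of
      \<open>bs\<close> form a proper subset of \<open>V\<close>.\<close>
    have "distinct bs" "set bs \<subseteq> V" "c \<in> V" "c \<notin> set bs" using fin wc that by auto
    then show ?thesis using that(2) V
      by (auto simp: nonresonant_def distinct_sum_list_conv_Sum)
  qed
  obtain ts where ts: "good_forest ts" "forest_word ts = w"
    using forest_word_surj[of w] pre nz by blast
  then obtain A ds where Ads: "ts = A # ds" using wne by (cases ts) auto
  have c: "c < 0" using pre[of w "[]"] wne tot wc by simp
  have g: "good A" "root A > 0" "good_forest ds" using ts(1) Ads by auto
  \<comment> \<open>The total is zero, so what \<open>c\<close> lacks after absorbing
    \<open>ds\<close> is exactly the positive sum of the bottom tree \<open>A\<close>.\<close>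
  have "tsum A + tsum (Node c ds) = 0"
    using tot sum_forest_word[of ts] unfolding wc ts(2) by (simp add: Ads tsum_Node)
  then have "tsum (Node c ds) < 0" using good_tsum_pos[OF g(1,2)] by simp
  then have gB: "good (Node c ds)"
    using c g(3) by (auto simp: good_forest_def mult_pos_neg intro: mult_neg_neg)
  have W: "xs = word A @ word (Node c ds)" using c wc ts(2) Ads by simp
  have "(A, Node c ds) \<in> good_pairs V"
    unfolding good_pairs_def using g gB c fin W mset_eq_imp_distinct_iff[of xs "labels A @ labels (Node c ds)"]
    by (metis (mono_tags, lifting) case_prodI mem_Collect_eq mset_append mset_word rtree.sel(1) set_append set_word)
  then show "\<exists>p\<in>good_pairs V. xs = (\<lambda>(A, B). word A @ word B) p"
    using W by (intro bexI[of _ "(A, Node c ds)"]) simp_all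
qed

text \<open>The cycle lemma: a cyclic word with total zero and no vanishing proper segment has
  exactly one cut with positive proper prefixes, namely the place where the prefix sum is
  least.\<close>

lemma positive_orders_rotate_bij:
  assumes V: "nonresonant V" and "card V \<ge> 2"
  shows "bij_betw (\<lambda>(xs, i). rotate i xs) (positive_orders V \<times> {..<card V})
           {xs. distinct xs \<and> set xs = V}"
proof (rule bij_betwI')
  let ?n = "card V"
  have tot: "sum_list xs = 0" "length xs = ?n" if "distinct xs" "set xs = V" for xs
    using that V by (auto simp: nonresonant_def distinct_sum_list_conv_Sum distinct_card)
  have D: "distinct xs" "set xs = V" "length xs = ?n" "sum_list xs = 0" if "xs \<in> positive_orders V" for xs
    using that tot by (auto simp: positive_orders_def)
  have P: "sum_list (take i xs) > 0" if "xs \<in> positive_orders V" "0 < i" "i < ?n" for xs i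
    using that D(3)[OF that(1)] by (auto simp: positive_orders_def)
  have key: "i = j \<and> xs = ys"
    if "xs \<in> positive_orders V" "ys \<in> positive_orders V" "i \<le> j" "j < ?n" "rotate i xs = rotate j ys"
    for xs ys i j
  proof -
    let ?d = "j - i"
    have "rotate j ys = rotate i (rotate ?d ys)" using that(3) by (simp add: rotate_rotate)
    then have "xs = rotate ?d ys"
      using that(5) inj_fn[OF inj_rotate1, of i]
      unfolding rotate_def by (metis injD)
    then have xs: "xs = drop ?d ys @ take ?d ys"
      using D(3)[OF that(2)] that(4) by (simp add: rotate_drop_take)
    \<comment> \<open>Otherwise the two pieces of \<open>ys\<close> are proper prefixes of the
      positive orders \<open>ys\<close> and \<open>xs\<close>, so both have positive sum, although
      together they sum to zero.\<close>
    have "?d = 0"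
    proof (rule ccontr)
      assume "?d \<noteq> 0"
      then have "sum_list (take ?d ys) > 0" "sum_list (take (?n - ?d) xs) > 0"
        using that P by auto
      moreover have "take (?n - ?d) xs = drop ?d ys"
        using D(3)[OF that(2)] by (simp add: xs)
      ultimately have "sum_list (take ?d ys @ drop ?d ys) > 0"
        unfolding sum_list_append by simp
      then show False using D(4)[OF that(2)] by simp
    qed
    then show ?thesis using xs that(3) by simp
  qed
  fix p q assume pq: "p \<in> positive_orders V \<times> {..<?n}" "q \<in> positive_orders V \<times> {..<?n}"
  obtain xs i ys j where e: "p = (xs, i)" "q = (ys, j)" by (metis surj_pair)
  have "rotate i xs = rotate j ys \<Longrightarrow> i = j \<and> xs = ys"
    using pq key[of xs ys i j] key[of ys xs j i] unfolding e by (cases "i \<le> j") auto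
  then show "((\<lambda>(xs, i). rotate i xs) p = (\<lambda>(xs, i). rotate i xs) q) = (p = q)"
    unfolding e by auto
next
  fix p assume "p \<in> positive_orders V \<times> {..<card V}"
  then show "(\<lambda>(xs, i). rotate i xs) p \<in> {xs. distinct xs \<and> set xs = V}"
    by (auto simp: positive_orders_def)
next
  fix zs assume "zs \<in> {xs. distinct xs \<and> set xs = V}"
  then have zs: "distinct zs" "set zs = V" by auto
  let ?n = "card V"
  have len: "length zs = ?n" and tot: "sum_list zs = 0"
    using zs V by (auto simp: nonresonant_def distinct_sum_list_conv_Sum distinct_card)
  let ?S = "\<lambda>d. sum_list (take d zs)"
  have "finite {..<?n}" "{..<?n} \<noteq> {}" using assms(2) by (auto simp: lessThan_empty_iff)
  then obtain d where d: "d < ?n" "\<And>e. e < ?n \<Longrightarrow> ?S d \<le> ?S e"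
    using ex_is_arg_min_if_finite[of "{..<?n}" ?S] by (auto simp: is_arg_min_linorder)
  let ?ys = "rotate d zs"
  have ys: "?ys = drop d zs @ take d zs" using d(1) len by (simp add: rotate_drop_take)
  have seg: "sum_list (drop a (take b zs)) \<noteq> 0" if "a < b" "b \<le> ?n" "b - a < ?n" for a b
  proof -
    let ?bs = "drop a (take b zs)"
    have dis: "distinct ?bs" using zs(1) by simp
    have "card (set ?bs) = b - a" using distinct_card[OF dis] that len by simp
    moreover have "set ?bs \<subseteq> V" using zs(2) by (meson order_trans set_drop_subset set_take_subset)
    ultimately have "set ?bs \<subset> V" "set ?bs \<noteq> {}" using that by auto
    then have "\<Sum>(set ?bs) \<noteq> 0" using V unfolding nonresonant_def by blast
    then show ?thesis using dis by (simp add: distinct_sum_list_conv_Sum)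
  qed
  have segS: "sum_list (drop a (take b zs)) = ?S b - ?S a" if "a \<le> b" for a b
  proof -
    have "take b zs = take a zs @ drop a (take b zs)"
      using that by (metis append_take_drop_id min.absorb1 take_take)
    then show ?thesis by (metis add_diff_cancel_left' sum_list_append)
  qed
  \<comment> \<open>The prefix stays inside \<open>drop d zs\<close> or wraps around. In both cases
    its sum is \<open>?S e - ?S d\<close> for some \<open>e\<close>, which is nonnegative because
    \<open>?S d\<close> is least, and nonzero by \<open>seg\<close>.\<close>
  have "sum_list (take i ?ys) > 0" if i: "0 < i" "i < ?n" for i
  proof (cases "i \<le> ?n - d")
    case True
    then have "take i ?ys = drop d (take (d + i) zs)"
      unfolding ys using len by (simp add: take_drop add.commute)
    then have e: "sum_list (take i ?ys) = ?S (d + i) - ?S d" using segS[of d "d + i"] by simp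
    \<comment> \<open>Minimality covers only indices below \<open>?n\<close>; at
      \<open>d + i = ?n\<close> the prefix sum is the total zero, which equals
      \<open>?S 0\<close>.\<close>
    have "?S d \<le> ?S (d + i)"
      using d(2)[of "d + i"] d(2)[of 0] tot len True d(1) by (cases "d + i = ?n") auto
    moreover have "?S (d + i) - ?S d \<noteq> 0"
      using seg[of d "d + i"] segS[of d "d + i"] True i d(1) by auto
    ultimately show ?thesis using e by simp
  next
    case False
    let ?j = "i - (?n - d)"
    have j: "?j < d" using i d(1) False by linarith
    have "take i ?ys = drop d zs @ take ?j zs"
      unfolding ys using len False j by simp
    then have e: "sum_list (take i ?ys) = sum_list (drop d zs) + ?S ?j" by simp
    have "sum_list (drop d zs) = - ?S d"
      using tot by (metis append_take_drop_id sum_list_append add_eq_0_iff add.commute)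
    moreover have "?S ?j \<le> ?S d \<Longrightarrow> ?S d = ?S ?j" using d(2)[of ?j] j d(1) by simp
    moreover have "?S d - ?S ?j \<noteq> 0"
      using seg[of ?j d] segS[of ?j d] j d(1) i by auto
    ultimately show ?thesis using e by linarith
  qed
  then have "?ys \<in> positive_orders V" using zs len by (simp add: positive_orders_def)
  \<comment> \<open>The reduction modulo \<open>?n\<close> matters for \<open>d = 0\<close>, where
    \<open>?n - d\<close> is outside the index range.\<close>
  moreover have "rotate ((?n - d) mod ?n) ?ys = zs"
    using len d(1) by (metis add.commute le_add_diff_inverse less_imp_le_nat length_rotate rotate_conv_mod rotate_id rotate_rotate mod_self)
  ultimately show "\<exists>p\<in>positive_orders V \<times> {..<card V}. zs = (\<lambda>(xs, i). rotate i xs) p"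
    using d(1) by (intro bexI[of _ "(?ys, (?n - d) mod ?n)"]) auto
qed

lemma card_good_pairs:
  assumes V: "nonresonant V" and n: "card V \<ge> 2"
  shows "card (good_pairs V) = fact (card V - 1)"
proof -
  have fin: "finite V" using V by (simp add: nonresonant_def)
  have "{xs. distinct xs \<and> set xs = V} = {xs. length xs = card V \<and> distinct xs \<and> set xs \<subseteq> V}"
    using fin by (auto simp: distinct_card) (metis card_subset_eq distinct_card subsetD)
  then have "card {xs. distinct xs \<and> set xs = V} = fact (card V)"
    using card_lists_distinct_length_eq[OF fin order_refl] n
    by (simp add: fact_prod numeral_2_eq_2)
  then have "card (positive_orders V) * card V = fact (card V)"
    using bij_betw_same_card[OF positive_orders_rotate_bij[OF assms]]
    by (simp add: card_cartesian_product)
  also have "\<dots> = fact (card V - 1) * card V"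
    using n fact_reduce[of "card V", where 'a = nat] by simp
  finally have "card (positive_orders V) = fact (card V - 1)" using n by simp
  then show ?thesis using bij_betw_same_card[OF good_pairs_bij[OF assms]] by simp
qed

section \<open>Cyclic orders cut open into lists\<close>

definition cyc_list :: "('a \<Rightarrow> 'a) \<Rightarrow> 'a set \<Rightarrow> 'a list \<Rightarrow> bool" where
  "cyc_list f S xs \<longleftrightarrow> distinct xs \<and> set xs = S \<and>
     (\<forall>i < length xs. f (xs ! i) = xs ! (Suc i mod length xs))"

text \<open>The cyclic order can be cut open at a prescribed element. With the parent of a vertex in
  that place, the rest is the list of its children.\<close>

lemma cyc_list_exists:
  assumes "cyclic_on f S" "p \<in> S"
  shows "\<exists>xs. cyc_list f S (p # xs)"
proof -
  have p: "p \<in> orbit f p" and S: "S = orbit f p" using assms by (auto simp: cyclic_on_alldef)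
  let ?n = "funpow_dist1 f p p"
  let ?ys = "map (\<lambda>i. (f ^^ i) p) [0..<?n]"
  have "distinct ?ys"
    using inj_on_funpow_dist1[OF p] by (simp add: distinct_map atLeast0LessThan del: upt_Suc)
  moreover have "set ?ys = S"
    unfolding S orbit_conv_funpow_dist1[OF p] by (simp add: atLeast0LessThan del: upt_Suc)
  moreover have "f (?ys ! i) = ?ys ! (Suc i mod length ?ys)" if "i < length ?ys" for i
  proof (cases "Suc i = ?n")
    case True
    then have "f ((f ^^ i) p) = p" using funpow_dist1_prop[OF p] by (metis funpow.simps(2) comp_apply)
    then show ?thesis using True that by (simp del: upt_Suc)
  next
    case False
    then show ?thesis using that by (simp del: upt_Suc)
  qed
  ultimately have "cyc_list f S ?ys" by (simp add: cyc_list_def)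
  moreover have "?ys = p # map (\<lambda>i. (f ^^ i) p) [1..<?n]"
    by (subst upt_conv_Cons) auto
  ultimately show ?thesis by metis
qed

lemma cyc_list_funpow:
  assumes "cyc_list f S xs" "xs \<noteq> []"
  shows "(f ^^ i) (xs ! 0) = xs ! (i mod length xs)"
proof (induction i)
  case (Suc i)
  then show ?case using assms by (simp add: cyc_list_def mod_Suc_eq)
qed simp

lemma cyc_list_cyclic_on:
  assumes "cyc_list f S xs" "xs \<noteq> []"
  shows "cyclic_on f S"
proof -
  let ?n = "length xs"
  have "orbit f (xs ! 0) = S"
  proof
    show "orbit f (xs ! 0) \<subseteq> S"
      using assms by (auto simp: orbit_altdef cyc_list_funpow cyc_list_def)
    show "S \<subseteq> orbit f (xs ! 0)"
    proof
      fix x assume "x \<in> S"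
      then obtain i where i: "i < ?n" "x = xs ! i" using assms by (auto simp: cyc_list_def in_set_conv_nth)
      \<comment> \<open>\<open>orbit\<close> contains only iterates with positive exponent, so a
        full turn is added to reach index 0 as well.\<close>
      have "(f ^^ (i + ?n)) (xs ! 0) = x" unfolding cyc_list_funpow[OF assms] using i by simp
      then show "x \<in> orbit f (xs ! 0)" using assms(2) unfolding orbit_altdef by force
    qed
  qed
  moreover have "xs ! 0 \<in> S" using assms by (auto simp: cyc_list_def)
  ultimately show ?thesis unfolding cyclic_on_def by metis
qed

lemma cyc_list_unique:
  assumes "cyc_list f S (p # xs)" "cyc_list f S (p # ys)"
  shows "xs = ys"
proof -
  have "length (p # xs) = card S" "length (p # ys) = card S"
    using assms unfolding cyc_list_def by (metis distinct_card)+
  moreover have "(p # xs) ! i = (p # ys) ! i" if "i < card S" for i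
    using cyc_list_funpow[OF assms(1), of i] cyc_list_funpow[OF assms(2), of i] that calculation
    by (simp del: length_Cons)
  ultimately have "p # xs = p # ys" by (intro nth_equalityI) auto
  then show ?thesis by simp
qed

lemma cyc_list_map:
  assumes "cyc_list g S xs" "inj_on f S" "\<And>u. u \<in> S \<Longrightarrow> h (f u) = f (g u)"
  shows "cyc_list h (f ` S) (map f xs)"
proof -
  have "h (map f xs ! i) = map f xs ! (Suc i mod length xs)" if "i < length xs" for i
  proof -
    have "xs ! i \<in> S" using assms(1) that by (auto simp: cyc_list_def)
    moreover have "Suc i mod length xs < length xs" using that by (intro mod_less_divisor) linarith
    ultimately show ?thesis using assms(1,3) that by (simp add: cyc_list_def)
  qed
  then show ?thesis using assms by (auto simp: cyc_list_def distinct_map)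
qed

lemma cyc_list_map_iff:
  assumes "cyc_list g S xs" "cyc_list h S' (map f xs)"
  shows "S' = f ` S" and "u \<in> S \<Longrightarrow> h (f u) = f (g u)"
proof -
  show "S' = f ` S" using assms by (auto simp: cyc_list_def)
  assume "u \<in> S"
  then obtain i where i: "i < length xs" "u = xs ! i"
    using assms by (auto simp: cyc_list_def in_set_conv_nth)
  have "Suc i mod length xs < length xs" using i(1) by (intro mod_less_divisor) linarith
  then show "h (f u) = f (g u)" using assms i by (auto simp: cyc_list_def)
qed

subsection \<open>Walks without backtracking\<close>

fun nbwalk :: "nat set set \<Rightarrow> nat list \<Rightarrow> bool" where
  "nbwalk E (x # y # z # zs) \<longleftrightarrow> {x, y} \<in> E \<and> x \<noteq> z \<and> nbwalk E (y # z # zs)"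
| "nbwalk E [x, y] \<longleftrightarrow> {x, y} \<in> E"
| "nbwalk E _ \<longleftrightarrow> True"

lemma nbwalk_Cons: "nbwalk E (x # xs) \<Longrightarrow> nbwalk E xs"
  by (cases "(E, x # xs)" rule: nbwalk.cases) auto

text \<open>The condition concerns only three consecutive vertices, so two walks that overlap in one
  step can be joined.\<close>

lemma nbwalk_join:
  assumes "nbwalk E (xs @ [x, y])" "nbwalk E (x # y # ys)"
  shows "nbwalk E (xs @ x # y # ys)"
  using assms
proof (induction xs)
  case (Cons a xs)
  then show ?case by (cases xs; cases "tl xs") (auto split: list.splits)
qed simp

lemma nbwalk_rev: "nbwalk E w \<Longrightarrow> nbwalk E (rev w)"
proof (induction E w rule: nbwalk.induct)
  case (1 E x y z zs)
  moreover have "{y, z} \<in> E" using 1 by (cases zs) auto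
  ultimately have "nbwalk E (rev zs @ [z, y])" "nbwalk E [z, y, x]" by (auto simp: insert_commute)
  then show ?case using nbwalk_join[of E "rev zs" z y "[x]"] by simp
qed (auto simp: insert_commute)

lemma nbwalk_edge: "nbwalk E w \<Longrightarrow> Suc i < length w \<Longrightarrow> {w ! i, w ! Suc i} \<in> E"
proof (induction E w arbitrary: i rule: nbwalk.induct)
  case (1 E x y z zs)
  then show ?case by (cases i) auto
qed auto

lemma nbwalk_append1: "nbwalk E (xs @ ys) \<Longrightarrow> nbwalk E xs"
proof -
  have "nbwalk E (us @ vs) \<Longrightarrow> nbwalk E vs" for us vs
    by (induction us) (auto dest: nbwalk_Cons)
  then show "nbwalk E (xs @ ys) \<Longrightarrow> nbwalk E xs"
    by (metis nbwalk_rev rev_append rev_rev_ident)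
qed

lemma simple_graph_edge:
  assumes "is_simple_graph T" "{u, v} \<in> edges T"
  shows "u \<in> verts T" "v \<in> verts T" "u \<noteq> v"
  using assms by (auto simp: is_simple_graph_def)

text \<open>By induction the tail has no repetition, so a return to \<open>x\<close> closes a loop
  \<open>x # us\<close> of distinct vertices. With two or more vertices in \<open>us\<close> it is a
  cycle, with one it is a step back, with none an edge from \<open>x\<close> to itself.\<close>

lemma nbwalk_distinct:
  assumes T: "is_tree T" and "nbwalk (edges T) w"
  shows "distinct w"
  using assms(2)
proof (induction w)
  case (Cons x w)
  have dw: "distinct w" using Cons nbwalk_Cons by blast
  have sg: "is_simple_graph T" using T by (simp add: is_tree_def)
  have "x \<notin> set w"
  proof
    assume "x \<in> set w"
    then obtain us vs where w: "w = us @ x # vs" by (metis split_list)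
    have "nbwalk (edges T) ((x # us @ [x]) @ vs)" using Cons.prems w by simp
    then have nb: "nbwalk (edges T) (x # us @ [x])" by (rule nbwalk_append1)
    have d: "distinct (x # us)" using dw w by simp
    show False
    proof (cases "length us \<ge> 2")
      case True
      have "{(x # us) ! i, (x # us) ! (Suc i mod length (x # us))} \<in> edges T"
        if "i < length (x # us)" for i
      proof -
        have e: "{(x # us @ [x]) ! i, (x # us @ [x]) ! Suc i} \<in> edges T"
          using nbwalk_edge[OF nb, of i] that by simp
        have 1: "(x # us @ [x]) ! i = (x # us) ! i"
          using that by (metis append_Cons nth_append)
        have 2: "(x # us @ [x]) ! Suc i = (x # us) ! (Suc i mod length (x # us))"
        proof (cases "Suc i = length (x # us)")
          case True
          then show ?thesis by (auto simp: nth_append)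
        next
          case False
          then have "Suc i < length (x # us)" using that by linarith
          then show ?thesis by (metis append_Cons nth_append mod_less)
        qed
        show ?thesis using e unfolding 1 2 .
      qed
      then have "is_cycle T (x # us)" using True d by (simp add: is_cycle_def)
      then show False using T by (auto simp: is_tree_def)
    next
      case False
      then consider "us = []" | y where "us = [y]" by (cases us; cases "tl us") auto
      then show False using nb simple_graph_edge(3)[OF sg, of x x] by cases auto
    qed
  qed
  then show ?case using dw by simp
qed simp

subsection \<open>Unfolding a plane tree from one of its edges\<close>

text \<open>
  \<open>unfolds T p t\<close>: the rose tree \<open>t\<close> is the part of \<open>T\<close> behind the edge from \<open>p\<close> to the root of
  \<open>t\<close>, where the children of each vertex are listed in rotation order, starting after the parent.
\<close>

fun unfolds :: "wtree \<Rightarrow> nat \<Rightarrow> nat rtree \<Rightarrow> bool" where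
  "unfolds T p (Node v ts) \<longleftrightarrow>
     cyc_list (rot T v) (nbrs T v) (p # map root ts) \<and> (\<forall>t \<in> set ts. unfolds T v t)"

text \<open>The colour condition keeps one of the two orders of the sides of an edge, so that each
  edge is counted once.\<close>

definition unfoldings :: "wtree \<Rightarrow> (nat rtree \<times> nat rtree) set" where
  "unfoldings T = {(A, B). unfolds T (root B) A \<and> unfolds T (root A) B \<and> white T (root A)}"

lemma unfolds_cyc_list:
  "unfolds T p t \<Longrightarrow> cyc_list (rot T (root t)) (nbrs T (root t)) (p # map root (kids t))"
  by (cases t) simp

lemma unfolds_edge: "unfolds T p t \<Longrightarrow> {p, root t} \<in> edges T"
  using unfolds_cyc_list[of T p t] by (auto simp: cyc_list_def nbrs_def insert_commute)

text \<open>The list around the root starts with the given parent, so the rotation fixes the order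
  of the children, and the argument descends.\<close>

lemma unfolds_unique:
  assumes "unfolds T p t" "unfolds T p t'" "root t = root t'"
  shows "t = t'"
  using assms
proof (induction t arbitrary: p t')
  case (Node v ts)
  obtain ts' where t': "t' = Node v ts'" using Node.prems(3) by (cases t') auto
  have eq: "map root ts = map root ts'"
    using Node.prems cyc_list_unique unfolding t' by auto
  have "ts = ts'"
  proof (rule nth_equalityI)
    show len: "length ts = length ts'" using eq by (metis length_map)
    show "ts ! i = ts' ! i" if "i < length ts" for i
    proof (rule Node.IH)
      show "ts ! i \<in> set ts" using that by simp
      show "unfolds T v (ts ! i)" "unfolds T v (ts' ! i)"
        using Node.prems that len unfolding t' by auto
      show "root (ts ! i) = root (ts' ! i)" using eq that len by (metis nth_map)
    qed
  qed
  then show ?case using t' by simp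
qed

lemma is_plane_treeD:
  assumes "is_plane_tree T"
  shows "is_tree T" "is_simple_graph T"
    "v \<in> verts T \<Longrightarrow> nbrs T v \<noteq> {} \<Longrightarrow> cyclic_on (rot T v) (nbrs T v)"
  using assms by (auto simp: is_plane_tree_def is_tree_def)

lemma nbwalk_verts:
  assumes "is_simple_graph T" "nbwalk (edges T) w" "length w \<ge> 2"
  shows "set w \<subseteq> verts T"
  using assms(2,3)
proof (induction "edges T" w rule: nbwalk.induct)
  case (1 x y z zs)
  then show ?case using simple_graph_edge[OF assms(1)] by auto
qed (use simple_graph_edge[OF assms(1)] in auto)

text \<open>The walk \<open>w\<close> records the way already travelled and makes the descent
  terminate: the extended walk never turns back, so in a tree its vertices are distinct and its
  length is bounded by the number of vertices.\<close>

lemma unfolds_exists_aux: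
  assumes T: "is_plane_tree T" and "nbwalk (edges T) (w @ [p, v])"
  shows "\<exists>t. root t = v \<and> unfolds T p t"
  using assms(2)
proof (induction "card (verts T) - length w" arbitrary: w p v rule: less_induct)
  case less
  note sg = is_plane_treeD(2)[OF T]
  have "nbwalk (edges T) [p, v]"
    using less.prems by (metis nbwalk_rev nbwalk_append1 rev_append rev_rev_ident)
  then have e: "{v, p} \<in> edges T" by (simp add: insert_commute)
  then have "p \<in> nbrs T v" "v \<in> verts T" using simple_graph_edge[OF sg] by (auto simp: nbrs_def)
  then obtain xs where xs: "cyc_list (rot T v) (nbrs T v) (p # xs)"
    using cyc_list_exists[of "rot T v" "nbrs T v" p] is_plane_treeD(3)[OF T] by auto
  have "\<exists>t. root t = c \<and> unfolds T v t" if "c \<in> set xs" for c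
  proof -
    have "c \<in> nbrs T v" "c \<noteq> p" using xs that by (auto simp: cyc_list_def)
    then have "nbwalk (edges T) [p, v, c]" using e by (auto simp: nbrs_def insert_commute)
    then have nb: "nbwalk (edges T) ((w @ [p]) @ [v, c])"
      using nbwalk_join[OF less.prems, of "[c]"] by simp
    have "distinct ((w @ [p]) @ [v, c])" using nb nbwalk_distinct is_plane_treeD(1)[OF T] by blast
    moreover have "set ((w @ [p]) @ [v, c]) \<subseteq> verts T"
      using nbwalk_verts[OF sg nb] by simp
    moreover have "finite (verts T)" using sg by (simp add: is_simple_graph_def)
    ultimately have "length ((w @ [p]) @ [v, c]) \<le> card (verts T)"
      by (metis card_mono distinct_card)
    then have "card (verts T) - length (w @ [p]) < card (verts T) - length w" by simp
    then show ?thesis using less.hyps nb by blast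
  qed
  then obtain g where g: "\<And>c. c \<in> set xs \<Longrightarrow> root (g c) = c \<and> unfolds T v (g c)" by metis
  have "map root (map g xs) = xs" using g by (simp add: map_idI)
  then show ?case using xs g by (intro exI[of _ "Node v (map g xs)"]) auto
qed

lemma unfolds_exists:
  assumes "is_plane_tree T" "{p, v} \<in> edges T"
  obtains t where "root t = v" "unfolds T p t"
  using unfolds_exists_aux[OF assms(1), of "[]" p v] assms(2) by auto

text \<open>These walks reduce all disjointness statements about unfolded subtrees to
  \<open>nbwalk_distinct\<close>.\<close>

lemma unfolds_walk:
  assumes "unfolds T p t" "u \<in> set_rtree t"
  shows "\<exists>ws. nbwalk (edges T) (p # root t # ws) \<and> u \<in> set (root t # ws)"
  using assms
proof (induction t arbitrary: p)
  case (Node v ts)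
  have e: "{p, v} \<in> edges T" using unfolds_edge[OF Node.prems(1)] by simp
  show ?case
  proof (cases "u = v")
    case True
    then show ?thesis using e by (intro exI[of _ "[]"]) simp
  next
    case False
    then obtain t where t: "t \<in> set ts" "u \<in> set_rtree t" using Node.prems by auto
    then obtain ws where ws: "nbwalk (edges T) (v # root t # ws)" "u \<in> set (root t # ws)"
      using Node.IH Node.prems by fastforce
    have "p \<noteq> root t" using Node.prems t by (auto simp: cyc_list_def)
    then show ?thesis using e ws by (intro exI[of _ "root t # ws"]) auto
  qed
qed

lemma unfolds_parent_notin:
  assumes "is_tree T" "unfolds T p t"
  shows "p \<notin> set_rtree t"
proof
  assume "p \<in> set_rtree t"
  then obtain ws where ws: "nbwalk (edges T) (p # root t # ws)" "p \<in> set (root t # ws)"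
    using unfolds_walk[OF assms(2)] by blast
  then show False using nbwalk_distinct[OF assms(1) ws(1)] by simp
qed

text \<open>A common vertex \<open>u\<close> would give a walk from \<open>u\<close> up to
  \<open>v\<close> through one child and down to \<open>u\<close> again through the other, without
  backtracking at \<open>v\<close>.\<close>

lemma unfolds_disjoint:
  assumes T: "is_tree T" and "unfolds T v t1" "unfolds T v t2" "root t1 \<noteq> root t2"
  shows "set_rtree t1 \<inter> set_rtree t2 = {}"
proof (rule ccontr)
  assume "\<not> ?thesis"
  then obtain u where u: "u \<in> set_rtree t1" "u \<in> set_rtree t2" by blast
  let ?c = "root t1" and ?d = "root t2"
  obtain w1 where w1: "nbwalk (edges T) (v # ?c # w1)" "u \<in> set (?c # w1)"
    using unfolds_walk[OF assms(2) u(1)] by blast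
  obtain w2 where w2: "nbwalk (edges T) (v # ?d # w2)" "u \<in> set (?d # w2)"
    using unfolds_walk[OF assms(3) u(2)] by blast
  have "nbwalk (edges T) [?c, v, ?d]"
    using unfolds_edge[OF assms(2)] unfolds_edge[OF assms(3)] assms(4) by (simp add: insert_commute)
  then have "nbwalk (edges T) ((rev w1 @ [?c]) @ [v, ?d])"
    using nbwalk_join[of "edges T" "rev w1" ?c v "[?d]"] nbwalk_rev[OF w1(1)] by simp
  then have "nbwalk (edges T) ((rev w1 @ [?c]) @ v # ?d # w2)"
    using nbwalk_join w2(1) by blast
  then show False using nbwalk_distinct[OF T] w1(2) w2(2) by fastforce
qed

lemma unfolds_distinct_labels:
  assumes T: "is_tree T" and "unfolds T p t"
  shows "distinct (labels t)"
  using assms(2)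
proof (induction t arbitrary: p)
  case (Node v ts)
  have un: "unfolds T v t" if "t \<in> set ts" for t using Node.prems that by simp
  have dr: "distinct (map root ts)" using Node.prems by (simp add: cyc_list_def)
  \<comment> \<open>Distinct roots make the label lists pairwise different, as
    \<open>distinct_concat\<close> requires.\<close>
  have hd: "hd (labels t) = root t" for t :: "nat rtree" by (cases t) simp
  have "distinct (concat (map labels ts))"
  proof (rule distinct_concat)
    have "distinct (map hd (map labels ts))" using dr hd by (simp add: comp_def)
    then show "distinct (map labels ts)" by (simp only: distinct_map)
    show "distinct ys" if "ys \<in> set (map labels ts)" for ys using that Node.IH un by auto
    show "set ys \<inter> set zs = {}"
      if "ys \<in> set (map labels ts)" "zs \<in> set (map labels ts)" "ys \<noteq> zs" for ys zs
    proof -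
      obtain t1 t2 where t: "t1 \<in> set ts" "t2 \<in> set ts" "t1 \<noteq> t2" "ys = labels t1" "zs = labels t2"
        using \<open>ys \<in> _\<close> \<open>zs \<in> _\<close> \<open>ys \<noteq> zs\<close> by auto
      then have "root t1 \<noteq> root t2" using dr by (auto simp: distinct_map inj_on_def)
      then show ?thesis using unfolds_disjoint[OF T un[OF t(1)] un[OF t(2)]] t by simp
    qed
  qed
  moreover have "v \<notin> set_rtree t" if "t \<in> set ts" for t
    using unfolds_parent_notin[OF T un[OF that]] .
  ultimately show ?case by auto
qed

text \<open>As for two children of a vertex, but here the walk passes across the edge between the
  two roots.\<close>

lemma unfoldings_disjoint:
  assumes T: "is_tree T" and "unfolds T (root B) A" "unfolds T (root A) B"
  shows "set_rtree A \<inter> set_rtree B = {}"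
proof (rule ccontr)
  assume "\<not> ?thesis"
  then obtain u where u: "u \<in> set_rtree A" "u \<in> set_rtree B" by blast
  let ?a = "root A" and ?b = "root B"
  obtain w1 where w1: "nbwalk (edges T) (?b # ?a # w1)" "u \<in> set (?a # w1)"
    using unfolds_walk[OF assms(2) u(1)] by blast
  obtain w2 where w2: "nbwalk (edges T) (?a # ?b # w2)" "u \<in> set (?b # w2)"
    using unfolds_walk[OF assms(3) u(2)] by blast
  have "nbwalk (edges T) (rev w1 @ ?a # ?b # w2)"
    using nbwalk_join[of "edges T" "rev w1" ?a ?b w2] nbwalk_rev[OF w1(1)] w2(1) by simp
  then show False using nbwalk_distinct[OF T] w1(2) w2(2) by fastforce
qed

text \<open>A subtree can be left only through its parent. For the two sides of an edge this makes
  their union closed under adjacency, hence everything by connectedness.\<close>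

lemma unfolds_nbrs:
  assumes "unfolds T p t" "x \<in> set_rtree t"
  shows "nbrs T x \<subseteq> insert p (set_rtree t)"
  using assms
proof (induction t arbitrary: p)
  case (Node v ts)
  show ?case
  proof (cases "x = v")
    case True
    then have "nbrs T x = insert p (root ` set ts)" using Node.prems by (auto simp: cyc_list_def)
    then show ?thesis by auto
  next
    case False
    then obtain t where t: "t \<in> set ts" "x \<in> set_rtree t" using Node.prems by auto
    then have "nbrs T x \<subseteq> insert v (set_rtree t)" using Node by fastforce
    then show ?thesis using t by auto
  qed
qed

lemma unfolds_verts:
  assumes "is_simple_graph T" "unfolds T p t"
  shows "set_rtree t \<subseteq> verts T"
  using assms(2)
proof (induction t arbitrary: p)
  case (Node v ts)
  have "v \<in> verts T" using unfolds_edge[OF Node.prems] simple_graph_edge[OF assms(1)] by auto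
  then show ?case using Node by fastforce
qed

lemma unfoldings_verts:
  assumes T: "is_tree T" and "unfolds T (root B) A" "unfolds T (root A) B"
  shows "set_rtree A \<union> set_rtree B = verts T"
proof
  have sg: "is_simple_graph T" and con: "is_connected T" using T by (auto simp: is_tree_def)
  show sub: "set_rtree A \<union> set_rtree B \<subseteq> verts T"
    using unfolds_verts[OF sg] assms by blast
  have "x \<in> set_rtree A \<union> set_rtree B" if "(root A, x) \<in> (adj T)\<^sup>*" for x
    using that
  proof (induction rule: rtrancl_induct)
    case (step y z)
    have "z \<in> nbrs T y" using step(2) by (simp add: adj_def nbrs_def)
    then show ?case using unfolds_nbrs[OF assms(2), of y] unfolds_nbrs[OF assms(3), of y] step(3)
      root_in_set[of A] root_in_set[of B] by (auto simp del: root_in_set)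
  qed simp
  moreover have "root A \<in> verts T" using sub by auto
  ultimately show "verts T \<subseteq> set_rtree A \<union> set_rtree B"
    using con unfolding is_connected_def by blast
qed

text \<open>Each vertex of \<open>t\<close> accounts for the edge to its parent; for the root this
  is \<open>{p, root t}\<close>.\<close>

lemma card_edges_touching:
  assumes T: "is_tree T" and "unfolds T p t"
  shows "card {e \<in> edges T. e \<inter> set_rtree t \<noteq> {}} = card (set_rtree t)"
  using assms(2)
proof (induction t arbitrary: p)
  case (Node v ts)
  have sg: "is_simple_graph T" using T by (simp add: is_tree_def)
  have pair: "\<exists>x y. e = {x, y} \<and> x \<in> X \<and> y \<in> nbrs T x" if "e \<in> edges T" "e \<inter> X \<noteq> {}" for e X
  proof -
    obtain a b where ab: "e = {a, b}" using sg \<open>e \<in> edges T\<close> by (auto simp: is_simple_graph_def card_2_iff)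
    then have ba: "e = {b, a}" by (simp add: insert_commute)
    have "a \<in> X \<or> b \<in> X" using that(2) ab by simp
    then show ?thesis using that(1) ab ba unfolding nbrs_def mem_Collect_eq by metis
  qed
  have fin: "finite (edges T)"
    using sg by (auto simp: is_simple_graph_def intro: finite_subset[of _ "Pow (verts T)"])
  let ?E = "\<lambda>t. {e \<in> edges T. e \<inter> set_rtree t \<noteq> {}}"
  have un: "unfolds T v t" if "t \<in> set ts" for t using Node.prems that by simp
  have dr: "distinct (map root ts)" using Node.prems by (simp add: cyc_list_def)
  have nv: "nbrs T v = insert p (root ` set ts)" using Node.prems by (auto simp: cyc_list_def)
  have disj: "set_rtree t \<inter> set_rtree t' = {}" if "t \<in> set ts" "t' \<in> set ts" "t \<noteq> t'" for t t'
    using unfolds_disjoint[OF T un un] that dr by (auto simp: distinct_map inj_on_def)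
  have vn: "v \<notin> set_rtree t" if "t \<in> set ts" for t
    using unfolds_parent_notin[OF T un[OF that]] .
  have pn: "p \<notin> set_rtree (Node v ts)" using unfolds_parent_notin[OF T Node.prems] .
  \<comment> \<open>An edge that meets \<open>t\<close> has its other end in \<open>t\<close> or at
    \<open>v\<close>, and none of these vertices lies in \<open>t'\<close>.\<close>
  have disjE: "?E t \<inter> ?E t' = {}" if "t \<in> set ts" "t' \<in> set ts" "t \<noteq> t'" for t t'
  proof -
    have False if e: "e \<in> edges T" "e \<inter> set_rtree t \<noteq> {}" "e \<inter> set_rtree t' \<noteq> {}" for e
    proof -
      obtain x y where "e = {x, y}" "x \<in> set_rtree t" "y \<in> nbrs T x" using pair[OF e(1,2)] by blast
      then show False
        using unfolds_nbrs[OF un[OF \<open>t \<in> set ts\<close>]] disj[OF \<open>t \<in> set ts\<close> \<open>t' \<in> set ts\<close> \<open>t \<noteq> t'\<close>]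
          vn[OF \<open>t' \<in> set ts\<close>] e(3) by blast
    qed
    then show ?thesis by blast
  qed
  have "?E (Node v ts) = insert {p, v} (\<Union>t\<in>set ts. ?E t)"
  proof
    show "?E (Node v ts) \<subseteq> insert {p, v} (\<Union>t\<in>set ts. ?E t)"
    proof
      fix e assume e: "e \<in> ?E (Node v ts)"
      then obtain x y where xy: "e = {x, y}" "x \<in> set_rtree (Node v ts)" "y \<in> nbrs T x"
        using pair by blast
      show "e \<in> insert {p, v} (\<Union>t\<in>set ts. ?E t)"
      proof (cases "x = v")
        case True
        then consider "y = p" | t where "t \<in> set ts" "y = root t" using xy(3) nv by auto
        then show ?thesis
        proof cases
          case 1
          then show ?thesis using xy(1) True by (simp add: insert_commute)
        next
          case (2 t)
          then have "y \<in> e \<inter> set_rtree t" using xy(1) by simp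
          then have "e \<in> ?E t" using e by blast
          then show ?thesis using 2 by blast
        qed
      next
        case False
        then show ?thesis using xy e by auto
      qed
    qed
    show "insert {p, v} (\<Union>t\<in>set ts. ?E t) \<subseteq> ?E (Node v ts)"
      using unfolds_edge[OF Node.prems] by auto
  qed
  moreover have "{p, v} \<notin> (\<Union>t\<in>set ts. ?E t)" using vn pn by auto
  moreover have "card (\<Union>t\<in>set ts. ?E t) = (\<Sum>t\<in>set ts. card (?E t))"
    using disjE fin by (intro card_UN_disjoint) auto
  moreover have "card (\<Union>t\<in>set ts. set_rtree t) = (\<Sum>t\<in>set ts. card (set_rtree t))"
    using disj by (intro card_UN_disjoint) (auto simp flip: set_labels)
  moreover have "(\<Sum>t\<in>set ts. card (?E t)) = (\<Sum>t\<in>set ts. card (set_rtree t))"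
    using Node.IH un by (intro sum.cong) auto
  moreover have "v \<notin> (\<Union>t\<in>set ts. set_rtree t)" using vn by auto
  moreover have "finite (\<Union>t\<in>set ts. set_rtree t)" by (auto simp flip: set_labels)
  moreover have "finite (\<Union>t\<in>set ts. ?E t)" using fin by auto
  ultimately show ?case by simp
qed

text \<open>The colouring tells which end of an edge is the root of \<open>A\<close>; the two roots
  then determine both trees.\<close>

lemma unfoldings_edges_bij:
  assumes T: "is_plane_tree T" and "properly_colored T"
  shows "bij_betw (\<lambda>(A, B). {root A, root B}) (unfoldings T) (edges T)"
proof (rule bij_betwI')
  fix P Q assume PQ: "P \<in> unfoldings T" "Q \<in> unfoldings T"
  obtain A B A' B' where e: "P = (A, B)" "Q = (A', B')" by (metis surj_pair)
  have U: "unfolds T (root B) A" "unfolds T (root A) B" "white T (root A)"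
    "unfolds T (root B') A'" "unfolds T (root A') B'" "white T (root A')"
    using PQ unfolding e unfoldings_def by auto
  have "\<not> white T (root B)" using U assms(2) unfolds_edge[OF U(1)] unfolding properly_colored_def by blast
  then have "root A = root A' \<and> root B = root B'" if "{root A, root B} = {root A', root B'}"
    using that U by (auto simp: doubleton_eq_iff)
  then have "P = Q" if "{root A, root B} = {root A', root B'}"
    using that U unfolds_unique unfolding e by metis
  then show "((\<lambda>(A, B). {root A, root B}) P = (\<lambda>(A, B). {root A, root B}) Q) = (P = Q)"
    unfolding e by auto
next
  fix P assume "P \<in> unfoldings T"
  then show "(\<lambda>(A, B). {root A, root B}) P \<in> edges T"
    using unfolds_edge by (auto simp: unfoldings_def insert_commute)
next
  fix e assume e: "e \<in> edges T"
  then obtain a b where ab: "e = {a, b}" "white T a"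
    using is_plane_treeD(2)[OF T] assms(2)
    by (auto simp: is_simple_graph_def card_2_iff properly_colored_def) (metis insert_commute)
  obtain A where A: "root A = a" "unfolds T b A"
    using unfolds_exists[OF T, of b a] e ab by (auto simp: insert_commute)
  obtain B where B: "root B = b" "unfolds T a B"
    using unfolds_exists[OF T, of a b] e ab by auto
  show "\<exists>P\<in>unfoldings T. e = (\<lambda>(A, B). {root A, root B}) P"
    using A B ab by (intro bexI[of _ "(A, B)"]) (auto simp: unfoldings_def)
qed

text \<open>This amounts to counting the edges of a tree: cut at one edge, both sides touch as many
  edges as they have vertices, and only the cut edge is touched from both.\<close>

lemma card_unfoldings:
  assumes T: "is_plane_tree T" "properly_colored T" and ne: "card (verts T) \<ge> 2"
  shows "card (unfoldings T) = card (verts T) - 1"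
proof -
  note tr = is_plane_treeD(1)[OF T(1)] and sg = is_plane_treeD(2)[OF T(1)]
  obtain u v where uv: "u \<in> verts T" "v \<in> verts T" "u \<noteq> v"
    using ne by (metis card_le_Suc0_iff_eq card.infinite not_less_eq_eq numeral_2_eq_2 zero_le)
  then have "(u, v) \<in> (adj T)\<^sup>*" using tr by (auto simp: is_tree_def is_connected_def)
  then obtain w where "(u, w) \<in> adj T" using uv(3) by (metis converse_rtranclE)
  then obtain p v where e: "{p, v} \<in> edges T" by (auto simp: adj_def)
  obtain A where A: "root A = v" "unfolds T p A" using unfolds_exists[OF T(1) e] by blast
  obtain B where B: "root B = p" "unfolds T v B"
    using unfolds_exists[OF T(1), of v p] e by (auto simp: insert_commute)
  have disj: "set_rtree A \<inter> set_rtree B = {}" and V: "set_rtree A \<union> set_rtree B = verts T"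
    using unfoldings_disjoint[OF tr] unfoldings_verts[OF tr] A B by auto
  let ?E = "\<lambda>t. {e \<in> edges T. e \<inter> set_rtree t \<noteq> {}}"
  have fin: "finite (edges T)"
    using sg by (auto simp: is_simple_graph_def intro: finite_subset[of _ "Pow (verts T)"])
  have "?E A \<union> ?E B = edges T"
  proof -
    have "e \<inter> verts T \<noteq> {}" if "e \<in> edges T" for e
      using sg that by (auto simp: is_simple_graph_def card_2_iff)
    then show ?thesis using V by auto
  qed
  moreover have "?E A \<inter> ?E B = {{p, v}}"
  proof
    show "{{p, v}} \<subseteq> ?E A \<inter> ?E B" using e root_in_set[of A] root_in_set[of B] A(1) B(1)
      by (auto simp del: root_in_set)
    show "?E A \<inter> ?E B \<subseteq> {{p, v}}"
    proof
      fix e assume "e \<in> ?E A \<inter> ?E B"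
      then obtain x y where xy: "x \<in> set_rtree A" "y \<in> set_rtree B" "x \<in> e" "y \<in> e" "e \<in> edges T" by blast
      then have "x \<noteq> y" using disj by blast
      moreover obtain a b where "e = {a, b}" using xy(5) sg by (auto simp: is_simple_graph_def card_2_iff)
      ultimately have e: "e = {x, y}" using xy by auto
      then have "y \<in> nbrs T x" "x \<in> nbrs T y" using xy(5) by (auto simp: nbrs_def insert_commute)
      then have "y = p" "x = v"
        using unfolds_nbrs[OF A(2) xy(1)] unfolds_nbrs[OF B(2) xy(2)] disj xy(1,2) by auto
      then show "e \<in> {{p, v}}" using e by auto
    qed
  qed
  moreover have "card (?E A) + card (?E B) = card (verts T)"
    using card_edges_touching[OF tr A(2)] card_edges_touching[OF tr B(2)] V disj
    by (metis card_Un_disjoint finite_set set_labels)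
  ultimately have "card (edges T) + 1 = card (verts T)"
    using card_Un_Int[of "?E A" "?E B"] fin by simp
  then show ?thesis using bij_betw_same_card[OF unfoldings_edges_bij[OF T]] by simp
qed

subsection \<open>Signed weights\<close>

definition signed_weight :: "wtree \<Rightarrow> nat \<Rightarrow> int" where
  "signed_weight T v = (if white T v then int (vweight T v) else - int (vweight T v))"

text \<open>For a simple type the signed weight identifies a vertex, so shapes do not depend on its name.\<close>

definition shapes :: "wtree \<Rightarrow> (int rtree \<times> int rtree) set" where
  "shapes T = map_prod (map_rtree (signed_weight T)) (map_rtree (signed_weight T)) ` unfoldings T"

lemma is_wtreeD:
  assumes "is_wtree T"
  shows "is_plane_tree T" "properly_colored T" "is_tree T" "is_simple_graph T"
    "\<And>v. v \<in> verts T \<Longrightarrow> vweight T v > 0"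
    "\<And>e. e \<in> edges T \<Longrightarrow> eweight T e > 0"
    "\<And>v. v \<in> verts T \<Longrightarrow> vweight T v = (\<Sum>e \<in> incident T v. eweight T e)"
  using assms by (auto simp: is_wtree_def is_plane_tree_def is_tree_def)

lemma sum_incident:
  assumes "is_simple_graph T" "distinct xs" "set xs = nbrs T v"
  shows "(\<Sum>e \<in> incident T v. eweight T e) = (\<Sum>u\<leftarrow>xs. eweight T {v, u})"
proof -
  have "incident T v = (\<lambda>u. {v, u}) ` nbrs T v"
  proof
    show "incident T v \<subseteq> (\<lambda>u. {v, u}) ` nbrs T v"
    proof
      fix e assume e: "e \<in> incident T v"
      then obtain a b where ab: "e = {a, b}" using assms(1)
        by (auto simp: incident_def is_simple_graph_def card_2_iff)
      then have ba: "e = {b, a}" by (simp add: insert_commute)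
      have "e \<in> edges T \<and> (v = a \<or> v = b)" using e ab by (auto simp: incident_def)
      then show "e \<in> (\<lambda>u. {v, u}) ` nbrs T v"
      proof (elim conjE disjE)
        assume "e \<in> edges T" "v = a"
        then show ?thesis using ab by (intro image_eqI[of _ _ b]) (simp_all add: nbrs_def)
      next
        assume "e \<in> edges T" "v = b"
        then show ?thesis using ba by (intro image_eqI[of _ _ a]) (simp_all add: nbrs_def)
      qed
    qed
    show "(\<lambda>u. {v, u}) ` nbrs T v \<subseteq> incident T v" by (auto simp: incident_def nbrs_def)
  qed
  moreover have "inj_on (\<lambda>u. {v, u}) (nbrs T v)" by (auto simp: inj_on_def doubleton_eq_iff)
  ultimately have "(\<Sum>e \<in> incident T v. eweight T e) = (\<Sum>u \<in> nbrs T v. eweight T {v, u})"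
    by (simp add: sum.reindex)
  then show ?thesis using assms(2,3) by (simp add: sum_list_distinct_conv_sum_set)
qed

text \<open>The weight of the root is the weight of the edge to its parent plus those of the edges
  to its children. The children contribute the latter with the opposite sign, so only the parent
  edge survives. In particular, the vertex weights determine the edge weights.\<close>

lemma unfolds_tsum:
  assumes T: "is_wtree T" and "unfolds T p t"
  shows "tsum (map_rtree (signed_weight T) t) =
    (if white T (root t) then 1 else -1) * int (eweight T {p, root t})"
  using assms(2)
proof (induction t arbitrary: p)
  case (Node v ts)
  note D = is_wtreeD[OF T]
  let ?s = "(if white T v then 1 else -1) :: int"
  have cyc: "cyc_list (rot T v) (nbrs T v) (p # map root ts)" using Node.prems by simp
  have v: "v \<in> verts T" using unfolds_verts[OF D(4) Node.prems] by simp
  have "vweight T v = eweight T {v, p} + (\<Sum>t\<leftarrow>ts. eweight T {v, root t})"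
    using D(7)[OF v] sum_incident[OF D(4), of "p # map root ts" v] cyc
    by (simp add: cyc_list_def comp_def)
  then have w: "int (vweight T v) = int (eweight T {v, p}) + (\<Sum>t\<leftarrow>ts. int (eweight T {v, root t}))"
    by (simp add: sum_list_of_nat[symmetric] comp_def)
  have "tsum (map_rtree (signed_weight T) t) = - ?s * int (eweight T {v, root t})" if "t \<in> set ts" for t
  proof -
    have u: "unfolds T v t" using Node.prems that by simp
    then have "white T (root t) \<noteq> white T v"
      using unfolds_edge[OF u] D(2) unfolding properly_colored_def by blast
    then show ?thesis using Node.IH[OF that u] by auto
  qed
  then have "(\<Sum>t\<leftarrow>ts. tsum (map_rtree (signed_weight T) t))
      = (\<Sum>t\<leftarrow>ts. - ?s * int (eweight T {v, root t}))"
    by (intro arg_cong[where f = sum_list] map_cong) auto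
  also have "\<dots> = - ?s * (\<Sum>t\<leftarrow>ts. int (eweight T {v, root t}))"
    by (rule sum_list_const_mult)
  finally have "tsum (map_rtree (signed_weight T) (Node v ts))
      = signed_weight T v - ?s * (\<Sum>t\<leftarrow>ts. int (eweight T {v, root t}))"
    by (simp add: tsum_Node comp_def)
  moreover have "signed_weight T v = ?s * int (vweight T v)" by (simp add: signed_weight_def)
  ultimately show ?case using w by (simp add: insert_commute algebra_simps)
qed

lemma unfolds_good:
  assumes T: "is_wtree T" and "unfolds T p t"
  shows "good (map_rtree (signed_weight T) t)"
  using assms(2)
proof (induction t arbitrary: p)
  case (Node v ts)
  note D = is_wtreeD[OF T]
  have v: "v \<in> verts T" using unfolds_verts[OF D(4) Node.prems] by simp
  have "signed_weight T (root t) * signed_weight T v < 0" if "t \<in> set ts" for t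
  proof -
    have u: "unfolds T v t" using Node.prems that by simp
    then have "white T (root t) \<noteq> white T v" "root t \<in> verts T"
      using unfolds_edge[OF u] D(2) simple_graph_edge[OF D(4)] unfolding properly_colored_def by blast+
    then show ?thesis using D(5) v by (auto simp: signed_weight_def mult_less_0_iff)
  qed
  moreover have "signed_weight T v * tsum (map_rtree (signed_weight T) (Node v ts)) > 0"
    unfolding unfolds_tsum[OF T Node.prems]
    using D(5)[OF v] D(6)[OF unfolds_edge[OF Node.prems]] by (simp add: signed_weight_def)
  ultimately show ?case using Node by auto
qed

lemma shapes_good_pairs:
  assumes T: "is_wtree T" and inj: "inj_on (signed_weight T) (verts T)"
  shows "shapes T \<subseteq> good_pairs (signed_weight T ` verts T)"
proof
  fix q assume "q \<in> shapes T"
  then obtain A B where q: "q = (map_rtree (signed_weight T) A, map_rtree (signed_weight T) B)"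
    and U: "unfolds T (root B) A" "unfolds T (root A) B" "white T (root A)"
    unfolding shapes_def unfoldings_def by auto
  note D = is_wtreeD[OF T]
  have "\<not> white T (root B)"
    using U D(2) unfolds_edge[OF U(1)] unfolding properly_colored_def by blast
  moreover have V: "set_rtree A \<union> set_rtree B = verts T" using unfoldings_verts[OF D(3) U(1,2)] .
  moreover have "distinct (labels A @ labels B)"
    using unfolds_distinct_labels[OF D(3)] U unfoldings_disjoint[OF D(3) U(1,2)] by simp
  then have "distinct (map (signed_weight T) (labels A @ labels B))"
    using inj V by (simp only: distinct_map) simp
  moreover have "root A \<in> verts T" "root B \<in> verts T" using V by auto
  ultimately show "q \<in> good_pairs (signed_weight T ` verts T)"
    unfolding q good_pairs_def using U unfolds_good[OF T] D(5)
    by (auto simp: labels_map rtree.set_map signed_weight_def)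
qed

text \<open>Distinct signed weights exclude symmetries, so different edges yield different shapes.
  This is the source of the factor by which trees with a distinguished edge outnumber trees.\<close>

lemma card_shapes:
  assumes T: "is_wtree T" and inj: "inj_on (signed_weight T) (verts T)" and "card (verts T) \<ge> 2"
  shows "card (shapes T) = card (verts T) - 1"
proof -
  note D = is_wtreeD[OF T]
  have "inj_on (map_rtree (signed_weight T)) {t. set_rtree t \<subseteq> verts T}"
    using inj by (auto intro!: inj_onI rtree.inj_map_strong[where f = "signed_weight T" and fa = "signed_weight T"] simp: inj_on_def subset_iff)
  moreover have "unfoldings T \<subseteq> {t. set_rtree t \<subseteq> verts T} \<times> {t. set_rtree t \<subseteq> verts T}"
    using unfolds_verts[OF D(4)] by (auto simp: unfoldings_def)
  ultimately have "inj_on (map_prod (map_rtree (signed_weight T)) (map_rtree (signed_weight T))) (unfoldings T)"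
    using inj_on_subset[OF map_prod_inj_on] by blast
  then show ?thesis using card_unfoldings[OF D(1,2) assms(3)] by (simp add: shapes_def card_image)
qed

subsection \<open>Shapes determine isotopy classes\<close>

lemma unfolds_map:
  assumes sg: "is_simple_graph T" and inj: "inj_on f (verts T)"
    and nb: "\<And>v. v \<in> verts T \<Longrightarrow> nbrs T' (f v) = f ` nbrs T v"
    and rt: "\<And>v u. v \<in> verts T \<Longrightarrow> u \<in> nbrs T v \<Longrightarrow> rot T' (f v) (f u) = f (rot T v u)"
    and "unfolds T p t"
  shows "unfolds T' (f p) (map_rtree f t)"
  using assms(5)
proof (induction t arbitrary: p)
  case (Node v ts)
  have v: "v \<in> verts T" using unfolds_verts[OF sg Node.prems] by simp
  have "nbrs T v \<subseteq> verts T" using simple_graph_edge[OF sg] by (auto simp: nbrs_def)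
  then have "cyc_list (rot T' (f v)) (f ` nbrs T v) (map f (p # map root ts))"
    using Node.prems rt[OF v] inj by (intro cyc_list_map[where g = "rot T v"]) (auto intro: inj_on_subset)
  then show ?case using Node nb[OF v] by (auto simp: comp_def)
qed

text \<open>An isomorphism transports neighbours, rotation and colours, hence unfoldings, and it
  preserves signed weights, hence their labels.\<close>

lemma isotopic_shapes_subset:
  assumes T: "is_wtree T" and T': "is_wtree T'" and "isotopic T T'"
  shows "shapes T \<subseteq> shapes T'"
proof
  fix q assume "q \<in> shapes T"
  then obtain A B where q: "q = (map_rtree (signed_weight T) A, map_rtree (signed_weight T) B)"
    and U: "unfolds T (root B) A" "unfolds T (root A) B" "white T (root A)"
    unfolding shapes_def unfoldings_def by auto
  note D = is_wtreeD[OF T]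
  obtain f where f: "plane_iso T T' f" using assms(3) by (auto simp: isotopic_def)
  have bij: "bij_betw f (verts T) (verts T')" and E: "edges T' = (\<lambda>e. f ` e) ` edges T"
    using f by (auto simp: plane_iso_def)
  have nb: "nbrs T' (f v) = f ` nbrs T v" if "v \<in> verts T" for v
    using isotopic_nbrs[OF T T' bij E that] .
  have W: "white T' (f v) = white T v" "signed_weight T' (f v) = signed_weight T v"
    if "v \<in> verts T" for v
    using f that by (auto simp: plane_iso_def signed_weight_def)
  have um: "unfolds T' (f p) (map_rtree f t)" if "unfolds T p t" for p t
    using unfolds_map[OF D(4) bij_betw_imp_inj_on[OF bij] nb _ that] f
    by (auto simp: plane_iso_def)
  have sub: "set_rtree A \<subseteq> verts T" "set_rtree B \<subseteq> verts T"
    using unfolds_verts[OF D(4)] U by auto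
  then have "root A \<in> verts T" by auto
  then have "(map_rtree f A, map_rtree f B) \<in> unfoldings T'"
    using um[OF U(1)] um[OF U(2)] U(3) W by (simp add: unfoldings_def)
  moreover have "map_rtree (signed_weight T') (map_rtree f t) = map_rtree (signed_weight T) t"
    if "set_rtree t \<subseteq> verts T" for t
    unfolding rtree.map_comp using that W by (intro rtree.map_cong) auto
  ultimately show "q \<in> shapes T'"
    unfolding shapes_def using sub by (intro image_eqI[of _ _ "(map_rtree f A, map_rtree f B)"]) (auto simp: q)
qed

text \<open>Each subtree comes with the label of its parent, \<open>p\<close> being the parent of
  the whole tree: these are the arguments met in the recursion of \<open>unfolds\<close>.\<close>

fun subtrees :: "'a \<Rightarrow> 'a rtree \<Rightarrow> ('a \<times> 'a rtree) set" where
  "subtrees p (Node v ts) = insert (p, Node v ts) (\<Union>t\<in>set ts. subtrees v t)"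

lemma subtrees_self [simp]: "(p, t) \<in> subtrees p t"
  by (cases t) simp

lemma subtrees_unfolds: "unfolds T p t \<Longrightarrow> (q, u) \<in> subtrees p t \<Longrightarrow> unfolds T q u"
proof (induction t arbitrary: p)
  case (Node v ts)
  then consider "(q, u) = (p, Node v ts)" | t where "t \<in> set ts" "(q, u) \<in> subtrees v t" by auto
  then show ?case
  proof cases
    case (2 t)
    then show ?thesis using Node.IH[OF 2(1) _ 2(2)] Node.prems(1) by simp
  qed (use Node.prems in simp)
qed

lemma subtrees_set: "(q, u) \<in> subtrees p t \<Longrightarrow> set_rtree u \<subseteq> set_rtree t"
proof (induction t arbitrary: p)
  case (Node v ts)
  then consider "u = Node v ts" | t where "t \<in> set ts" "(q, u) \<in> subtrees v t" by auto
  then show ?case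
  proof cases
    case (2 t)
    then show ?thesis using Node.IH[OF 2] by auto
  qed simp
qed

lemma subtrees_root: "x \<in> set_rtree t \<Longrightarrow> \<exists>q u. (q, u) \<in> subtrees p t \<and> root u = x"
proof (induction t arbitrary: p)
  case (Node v ts)
  show ?case
  proof (cases "x = v")
    case True
    then show ?thesis by (intro exI[of _ p] exI[of _ "Node v ts"]) simp
  next
    case False
    then obtain t where t: "t \<in> set ts" "x \<in> set_rtree t" using Node.prems by auto
    then obtain q u where "(q, u) \<in> subtrees v t" "root u = x" using Node.IH by blast
    then show ?thesis using t(1) by auto
  qed
qed

lemma subtrees_map: "(q, u) \<in> subtrees p t \<Longrightarrow> (f q, map_rtree f u) \<in> subtrees (f p) (map_rtree f t)"
proof (induction t arbitrary: p)
  case (Node v ts)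
  then consider "(q, u) = (p, Node v ts)" | t where "t \<in> set ts" "(q, u) \<in> subtrees v t" by auto
  then show ?case
  proof cases
    case (2 t)
    then show ?thesis using Node.IH[OF 2] by auto
  qed simp
qed

text \<open>The view from a single edge already determines the plane tree, so the shape sets of two
  trees of the type are equal or disjoint.\<close>

lemma isotopic_if_common_shape:
  assumes T: "is_wtree T" and T': "is_wtree T'"
    and bT: "bij_betw (signed_weight T) (verts T) V" and bT': "bij_betw (signed_weight T') (verts T') V"
    and q: "q \<in> shapes T" "q \<in> shapes T'"
  shows "isotopic T T'"
proof -
  note D = is_wtreeD[OF T] and D' = is_wtreeD[OF T']
  let ?r = "signed_weight T" and ?r' = "signed_weight T'"
  \<comment> \<open>The only candidate: each vertex goes to the vertex with the same signed
    weight.\<close>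
  define f where "f = inv_into (verts T') ?r' \<circ> ?r"
  have bij: "bij_betw f (verts T) (verts T')"
    unfolding f_def using bT bT' by (meson bij_betw_inv_into bij_betw_trans)
  have rf: "?r' (f v) = ?r v" if "v \<in> verts T" for v
    using bT bT' that by (simp add: f_def bij_betw_inv_into_right bij_betw_apply)
  have fv: "f v \<in> verts T'" if "v \<in> verts T" for v using bij_betw_apply[OF bij that] .
  have white: "white T' (f v) = white T v" if "v \<in> verts T" for v
    using rf[OF that] D(5)[OF that] D'(5)[OF fv[OF that]] by (auto simp: signed_weight_def split: if_splits)
  have vw: "vweight T' (f v) = vweight T v" if "v \<in> verts T" for v
    using rf[OF that] white[OF that] by (auto simp: signed_weight_def split: if_splits)
  obtain A B where q1: "q = (map_rtree ?r A, map_rtree ?r B)"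
    and U: "unfolds T (root B) A" "unfolds T (root A) B"
    using q(1) unfolding shapes_def unfoldings_def by auto
  obtain A' B' where q2: "q = (map_rtree ?r' A', map_rtree ?r' B')"
    and U': "unfolds T' (root B') A'" "unfolds T' (root A') B'"
    using q(2) unfolding shapes_def unfoldings_def by auto
  have "t' = map_rtree f t"
    if "map_rtree ?r' t' = map_rtree ?r t" "set_rtree t \<subseteq> verts T" "set_rtree t' \<subseteq> verts T'" for t t'
  proof -
    have "map_rtree ?r' (map_rtree f t) = map_rtree ?r t"
      unfolding rtree.map_comp using that(2) rf by (intro rtree.map_cong) auto
    then have "map_rtree ?r' t' = map_rtree ?r' (map_rtree f t)" using that(1) by simp
    moreover have "set_rtree (map_rtree f t) \<subseteq> verts T'" using that(2) fv by (auto simp: rtree.set_map)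
    ultimately show ?thesis
      using bT' that(3) by (intro rtree.inj_map_strong[of t' _ ?r' ?r']) (auto simp: bij_betw_def inj_on_def subset_iff)
  qed
  then have AB': "A' = map_rtree f A" "B' = map_rtree f B"
    using q1 q2 unfolds_verts[OF D(4)] unfolds_verts[OF D'(4)] U U' by auto
  \<comment> \<open>The cyclic list around \<open>v\<close> is read off the subtree headed by
    \<open>v\<close>, and the one around \<open>f v\<close> off the image of that subtree.\<close>
  have cyc: "\<exists>xs. cyc_list (rot T v) (nbrs T v) xs \<and> cyc_list (rot T' (f v)) (nbrs T' (f v)) (map f xs)"
    if v: "v \<in> verts T" for v
  proof -
    have "v \<in> set_rtree A \<union> set_rtree B" using unfoldings_verts[OF D(3) U] v by simp
    then obtain p u where u: "(p, u) \<in> subtrees (root B) A \<or> (p, u) \<in> subtrees (root A) B" "root u = v"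
      using subtrees_root by fast
    then have "(f p, map_rtree f u) \<in> subtrees (root B') A' \<or> (f p, map_rtree f u) \<in> subtrees (root A') B'"
      using subtrees_map by (metis AB' root_map)
    then have "unfolds T p u" "unfolds T' (f p) (map_rtree f u)"
      using u(1) U U' subtrees_unfolds by metis+
    from unfolds_cyc_list[OF this(1)] unfolds_cyc_list[OF this(2)] show ?thesis
      using u(2) by (intro exI[of _ "p # map root (kids u)"]) (simp add: comp_def)
  qed
  have nb: "nbrs T' (f v) = f ` nbrs T v" if "v \<in> verts T" for v
    using cyc[OF that] cyc_list_map_iff(1) by metis
  have rt: "rot T' (f v) (f u) = f (rot T v u)" if "v \<in> verts T" "u \<in> nbrs T v" for v u
    using cyc[OF that(1)] cyc_list_map_iff(2) that(2) by metis
  have two: "\<exists>x y. e = {x, y}" if "is_simple_graph S" "e \<in> edges S" for S e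
    using that unfolding is_simple_graph_def by (metis card_2_iff)
  have E: "edges T' = (\<lambda>e. f ` e) ` edges T"
  proof
    show "edges T' \<subseteq> (\<lambda>e. f ` e) ` edges T"
    proof
      fix e assume e: "e \<in> edges T'"
      then obtain x y where xy: "e = {x, y}" using two[OF D'(4)] by blast
      then have "x \<in> verts T'" using simple_graph_edge[OF D'(4)] e by blast
      then obtain v where v: "v \<in> verts T" "x = f v" using bij by (auto simp: bij_betw_def)
      then have "y \<in> f ` nbrs T v" using nb e xy by (auto simp: nbrs_def)
      then obtain u where "{v, u} \<in> edges T" "y = f u" by (auto simp: nbrs_def)
      then show "e \<in> (\<lambda>e. f ` e) ` edges T" using xy v by (intro image_eqI[of _ _ "{v, u}"]) auto
    qed
    show "(\<lambda>e. f ` e) ` edges T \<subseteq> edges T'"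
    proof
      fix e assume "e \<in> (\<lambda>e. f ` e) ` edges T"
      then obtain x y where xy: "{x, y} \<in> edges T" "e = {f x, f y}" using two[OF D(4)] by fastforce
      then have "y \<in> nbrs T x" "x \<in> verts T" using simple_graph_edge[OF D(4)] by (auto simp: nbrs_def)
      then have "f y \<in> nbrs T' (f x)" using nb by blast
      then show "e \<in> edges T'" using xy by (simp add: nbrs_def)
    qed
  qed
  \<comment> \<open>By \<open>unfolds_tsum\<close> an edge weight is, up to the sign given by the
    colour, the sum of the labels behind the edge, and \<open>f\<close> preserves those
    labels.\<close>
  have "eweight T' (f ` e) = eweight T e" if e: "e \<in> edges T" for e
  proof -
    obtain p v where pv: "e = {p, v}" using two[OF D(4) e] by blast
    then obtain t where t: "root t = v" "unfolds T p t" using unfolds_exists[OF D(1)] e by blast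
    have t': "unfolds T' (f p) (map_rtree f t)"
      using unfolds_map[OF D(4) bij_betw_imp_inj_on[OF bij] nb rt t(2)] by blast
    have sub: "set_rtree t \<subseteq> verts T" using unfolds_verts[OF D(4) t(2)] .
    then have v: "v \<in> verts T" using t(1) by auto
    have "map_rtree ?r' (map_rtree f t) = map_rtree ?r t"
      unfolding rtree.map_comp using sub rf by (intro rtree.map_cong) auto
    then show ?thesis
      using unfolds_tsum[OF T t(2)] unfolds_tsum[OF T' t'] t(1) white[OF v] pv
      by (auto split: if_splits)
  qed
  then have "plane_iso T T' f" unfolding plane_iso_def using bij E rt white vw by simp
  then show ?thesis unfolding isotopic_def by blast
qed

subsection \<open>The plane tree glued from two planted trees\<close>

lemma subtrees_cases:
  assumes "(q, u) \<in> subtrees p t"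
  shows "(q, u) = (p, t) \<or> (\<exists>q' s. (q', s) \<in> subtrees p t \<and> root s = q \<and> u \<in> set (kids s))"
  using assms
proof (induction t arbitrary: p)
  case (Node v ts)
  then consider "(q, u) = (p, Node v ts)" | t where "t \<in> set ts" "(q, u) \<in> subtrees v t" by auto
  then show ?case
  proof cases
    case (2 t)
    from Node.IH[OF 2] show ?thesis
    proof
      assume "(q, u) = (v, t)"
      then show ?thesis using 2 by (intro disjI2 exI[of _ p] exI[of _ "Node v ts"]) simp
    next
      assume "\<exists>q' s. (q', s) \<in> subtrees v t \<and> root s = q \<and> u \<in> set (kids s)"
      then obtain q' s where "(q', s) \<in> subtrees v t" "root s = q" "u \<in> set (kids s)" by blast
      then show ?thesis using 2 by (intro disjI2 exI[of _ q'] exI[of _ s]) auto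
    qed
  qed simp
qed

lemma subtrees_kid:
  "(q, s) \<in> subtrees p t \<Longrightarrow> u \<in> set (kids s) \<Longrightarrow> (root s, u) \<in> subtrees p t"
proof (induction t arbitrary: p)
  case (Node v ts)
  then consider "(q, s) = (p, Node v ts)" | t where "t \<in> set ts" "(q, s) \<in> subtrees v t" by auto
  then show ?case
  proof cases
    case 1
    then show ?thesis using Node.prems(2) by (auto intro!: bexI[of _ u])
  next
    case (2 t)
    then show ?thesis using Node.IH[OF 2 Node.prems(2)] by auto
  qed
qed

lemma distinct_labels_kids:
  assumes "distinct (labels t)" "u \<in> set (kids t)"
  shows "distinct (labels u)" "root t \<notin> set_rtree u"
    "u' \<in> set (kids t) \<Longrightarrow> u \<noteq> u' \<Longrightarrow> set_rtree u \<inter> set_rtree u' = {}"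
proof -
  obtain v ts where t: "t = Node v ts" by (cases t)
  obtain xs ys where ts: "ts = xs @ u # ys" using assms(2) t by (auto dest: split_list)
  show "distinct (labels u)" "root t \<notin> set_rtree u" using assms(1) unfolding t ts by auto
  assume "u' \<in> set (kids t)" "u \<noteq> u'"
  then have "u' \<in> set xs \<union> set ys" unfolding t ts by auto
  moreover have "set_rtree u \<inter> set_rtree w = {}" if "w \<in> set xs \<union> set ys" for w
    using assms(1) that unfolding t ts by fastforce
  ultimately show "set_rtree u \<inter> set_rtree u' = {}" by blast
qed

lemma distinct_map_root_kids:
  assumes "distinct (labels t)"
  shows "distinct (map root (kids t))"
proof -
  obtain v ts where t: "t = Node v ts" by (cases t)
  have "distinct (concat (map labels ts)) \<Longrightarrow> distinct (map root ts)"
  proof (induction ts)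
    case (Cons u ts)
    have "root u \<noteq> root w" if "w \<in> set ts" for w
      using Cons.prems that root_in_set[of u] root_in_set[of w]
      by (auto simp del: root_in_set)
    then show ?case using Cons by auto
  qed simp
  then show ?thesis using assms t by simp
qed

lemma subtrees_distinct:
  assumes "(q, u) \<in> subtrees p t" "distinct (labels t)" "p \<notin> set_rtree t"
  shows "distinct (labels u)" "q \<notin> set_rtree u"
proof -
  have "distinct (labels u) \<and> q \<notin> set_rtree u"
    using assms
  proof (induction t arbitrary: p)
    case (Node v ts)
    from Node.prems(1) consider "(q, u) = (p, Node v ts)"
      | t where "t \<in> set ts" "(q, u) \<in> subtrees v t" by auto
    then show ?case
    proof cases
      case 1
      then show ?thesis using Node.prems by simp
    next
      case (2 t)
      then show ?thesis using Node.IH[OF 2] distinct_labels_kids[OF Node.prems(2), of t] by simp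
    qed
  qed
  then show "distinct (labels u)" "q \<notin> set_rtree u" by auto
qed

lemma subtrees_unique:
  assumes "distinct (labels t)" "(q, u) \<in> subtrees p t" "(q', u') \<in> subtrees p t" "root u = root u'"
  shows "(q, u) = (q', u')"
  using assms
proof (induction t arbitrary: p)
  case (Node v ts)
  have inside: "root w \<noteq> v" "root w \<in> set_rtree t" if "t \<in> set ts" "(x, w) \<in> subtrees v t" for x w t
    using subtrees_set[OF that(2)] distinct_labels_kids(2)[OF Node.prems(1), of t] that(1)
      root_in_set[of w] by (auto simp del: root_in_set)
  show ?case
  proof (cases "root u = v")
    case True
    then show ?thesis using Node.prems(2-4) inside by auto
  next
    case False
    then obtain t t' where t: "t \<in> set ts" "(q, u) \<in> subtrees v t" "t' \<in> set ts" "(q', u') \<in> subtrees v t'"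
      using Node.prems(2-4) by auto
    then have "t = t'"
      using inside distinct_labels_kids(3)[OF Node.prems(1), of t t'] Node.prems(4)
      by (metis disjoint_iff rtree.sel(2))
    then show ?thesis
      using Node.IH[OF t(1) _ t(2)] t distinct_labels_kids(1)[OF Node.prems(1), of t] Node.prems(4) by simp
  qed
qed

lemma subtrees_good:
  assumes "(q, u) \<in> subtrees p t" "good (map_rtree r t)" "r p * r (root t) < 0"
  shows "good (map_rtree r u) \<and> r q * r (root u) < 0"
  using assms
proof (induction t arbitrary: p)
  case (Node v ts)
  from Node.prems(1) consider "(q, u) = (p, Node v ts)"
    | t where "t \<in> set ts" "(q, u) \<in> subtrees v t" by auto
  then show ?case
  proof cases
    case 1
    then show ?thesis using Node.prems by simp
  next
    case (2 t)
    then show ?thesis using Node.IH[OF 2] Node.prems(2) by (simp add: mult.commute)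
  qed
qed

lemma unfolds_if_subtrees:
  assumes "\<And>q u. (q, u) \<in> subtrees p t \<Longrightarrow>
    cyc_list (rot T (root u)) (nbrs T (root u)) (q # map root (kids u))"
  shows "unfolds T p t"
  using assms
proof (induction t arbitrary: p)
  case (Node v ts)
  have "unfolds T v t" if "t \<in> set ts" for t
    using that Node.prems by (intro Node.IH) auto
  then show ?case using Node.prems[of p "Node v ts"] by simp
qed

lemma subtrees_connected:
  assumes "\<And>q u. (q, u) \<in> subtrees p t \<Longrightarrow> (q, root u) \<in> R" "x \<in> set_rtree t"
  shows "(root t, x) \<in> R\<^sup>*"
  using assms
proof (induction t arbitrary: p)
  case (Node v ts)
  show ?case
  proof (cases "x = v")
    case False
    then obtain t where t: "t \<in> set ts" "x \<in> set_rtree t" using Node.prems(2) by auto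
    have sub: "(q, root u) \<in> R" if "(q, u) \<in> subtrees v t" for q u
      using Node.prems(1) t(1) that by auto
    then have "(v, root t) \<in> R" by simp
    moreover have "(root t, x) \<in> R\<^sup>*" using Node.IH[OF t(1) sub t(2)] .
    ultimately show ?thesis by (simp add: converse_rtrancl_into_rtrancl)
  qed simp
qed

lemma size_kid: "u \<in> set (kids t) \<Longrightarrow> length (labels u) < length (labels t)"
proof -
  assume "u \<in> set (kids t)"
  then obtain v xs ys where "t = Node v (xs @ u # ys)"
    by (metis rtree.exhaust_sel split_list)
  then show ?thesis by simp
qed

text \<open>
  If every vertex has at most one neighbour that is not below it in some ranking, a cycle cannot
  pass through its lowest vertex.
\<close>

lemma no_cycle_if_ranking:
  fixes h :: "nat \<Rightarrow> nat"
  assumes "\<And>v u w. {v, u} \<in> edges T \<Longrightarrow> {v, w} \<in> edges T \<Longrightarrow> h v \<le> h u \<Longrightarrow> h v \<le> h w \<Longrightarrow> u = w"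
  shows "\<not> is_cycle T p"
proof
  assume c: "is_cycle T p"
  let ?n = "length p"
  have n: "?n \<ge> 3" "distinct p" using c by (auto simp: is_cycle_def)
  have E: "{p ! i, p ! (Suc i mod ?n)} \<in> edges T" if "i < ?n" for i
    using c that by (simp add: is_cycle_def)
  obtain v where v: "v \<in> set p" "\<And>u. u \<in> set p \<Longrightarrow> h v \<le> h u"
  proof -
    have "set p \<noteq> {}" using n by auto
    then show ?thesis using that ex_is_arg_min_if_finite[of "set p" h] by (auto simp: is_arg_min_linorder)
  qed
  then obtain i where i: "i < ?n" "p ! i = v" by (auto simp: in_set_conv_nth)
  \<comment> \<open>\<open>j\<close> is the cyclic predecessor of \<open>i\<close>; as the length is
    at least 3, it differs from the successor.\<close>
  define j where "j = (if i = 0 then ?n - 1 else i - 1)"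
  have j: "j < ?n" "Suc j mod ?n = i" "Suc i mod ?n \<noteq> j"
    using n i unfolding j_def by (auto simp: mod_Suc)
  have k: "Suc i mod ?n < ?n" using n by (intro mod_less_divisor) linarith
  have "{v, p ! j} \<in> edges T" using E[OF j(1)] j(2) i by (simp add: insert_commute)
  moreover have "{v, p ! (Suc i mod ?n)} \<in> edges T" using E[OF i(1)] i by simp
  ultimately have "p ! j = p ! (Suc i mod ?n)"
    using assms v(2) j(1) k by (meson nth_mem)
  then show False using n(2) j k by (simp add: nth_eq_iff_index_eq)
qed

text \<open>A good pair whose labels have become vertex names, with \<open>r\<close> as signed
  weight. The assumption \<open>total\<close> makes the edge between the two roots get the same
  weight from either side.\<close>

locale edge_rooted =
  fixes r :: "nat \<Rightarrow> int" and A B :: "nat rtree"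
  assumes dist: "distinct (labels A @ labels B)"
    and good_A: "good (map_rtree r A)" and good_B: "good (map_rtree r B)"
    and root_A: "r (root A) > 0" and root_B: "r (root B) < 0"
    and total: "tsum (map_rtree r A) + tsum (map_rtree r B) = 0"
begin

text \<open>The roots of \<open>A\<close> and \<open>B\<close> serve as each other's parents, so
  every vertex has a parent and none is exceptional.\<close>

definition subs :: "(nat \<times> nat rtree) set" where
  "subs = subtrees (root B) A \<union> subtrees (root A) B"

definition V :: "nat set" where
  "V = set_rtree A \<union> set_rtree B"

definition node :: "nat \<Rightarrow> nat \<times> nat rtree" where
  "node v = (THE x. x \<in> subs \<and> root (snd x) = v)"

definition around :: "nat \<Rightarrow> nat list" where
  "around v = fst (node v) # map root (kids (snd (node v)))"

text \<open>That the definite descriptions for \<open>rot\<close> and \<open>eweight\<close> pick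
  the intended values at the edges of the tree is shown in \<open>cyc_list_glued\<close> and
  \<open>eweight_glued\<close>.\<close>

definition glued :: wtree where
  "glued = \<lparr>
     verts = V,
     edges = {{v, u} | v u. v \<in> V \<and> u \<in> set (around v)},
     rot = (\<lambda>v u. THE w. \<exists>i < length (around v). around v ! i = u \<and>
       w = around v ! (Suc i mod length (around v))),
     white = (\<lambda>v. r v > 0),
     vweight = (\<lambda>v. nat \<bar>r v\<bar>),
     eweight = (\<lambda>e. THE n. \<exists>p t. (p, t) \<in> subs \<and> e = {p, root t} \<and> n = nat \<bar>tsum (map_rtree r t)\<bar>)\<rparr>"

lemma disj: "set_rtree A \<inter> set_rtree B = {}" and dA: "distinct (labels A)" and dB: "distinct (labels B)"
  using dist by auto

lemma subs_A: "(root B, A) \<in> subs" and subs_B: "(root A, B) \<in> subs"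
  by (auto simp: subs_def)

lemma subs_unique: "(p, t) \<in> subs \<Longrightarrow> (p', t') \<in> subs \<Longrightarrow> root t = root t' \<Longrightarrow> (p, t) = (p', t')"
proof -
  assume a: "(p, t) \<in> subs" "(p', t') \<in> subs" "root t = root t'"
  have "root u \<in> set_rtree C" if "(q, u) \<in> subtrees x C" for q u x and C :: "nat rtree"
    using subtrees_set[OF that] by auto
  then consider "(p, t) \<in> subtrees (root B) A" "(p', t') \<in> subtrees (root B) A"
    | "(p, t) \<in> subtrees (root A) B" "(p', t') \<in> subtrees (root A) B"
    using a disj unfolding subs_def by (metis UnE disjoint_iff)
  then show ?thesis
    by cases (erule (1) subtrees_unique[OF dA _ _ a(3)], erule (1) subtrees_unique[OF dB _ _ a(3)])
qed

lemma node_root: "(p, t) \<in> subs \<Longrightarrow> node (root t) = (p, t)"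
  unfolding node_def using subs_unique by (intro the_equality) auto

lemma around_root: "(p, t) \<in> subs \<Longrightarrow> around (root t) = p # map root (kids t)"
  by (simp add: around_def node_root)

lemma subs_root: "v \<in> V \<Longrightarrow> \<exists>p t. (p, t) \<in> subs \<and> root t = v"
  unfolding V_def subs_def
  using subtrees_root[of v A "root B"] subtrees_root[of v B "root A"] by auto

lemma root_V: "(p, t) \<in> subs \<Longrightarrow> root t \<in> V"
  unfolding V_def subs_def
  using subtrees_set[of p t "root B" A] subtrees_set[of p t "root A" B] root_in_set[of t]
  by (auto simp del: root_in_set)

lemma subs_cases:
  assumes "(p, t) \<in> subs"
  obtains "p = root B" "t = A" | "p = root A" "t = B"
  | q s where "(q, s) \<in> subs" "root s = p" "t \<in> set (kids s)"
  using assms subtrees_cases[of p t "root B" A] subtrees_cases[of p t "root A" B]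
  unfolding subs_def by auto

lemma subs_kid: "(p, t) \<in> subs \<Longrightarrow> u \<in> set (kids t) \<Longrightarrow> (root t, u) \<in> subs"
  using subtrees_kid[of p t "root B" A u] subtrees_kid[of p t "root A" B u]
  unfolding subs_def by auto

lemma around_sym: "v \<in> V \<Longrightarrow> u \<in> set (around v) \<Longrightarrow> u \<in> V \<and> v \<in> set (around u)"
proof -
  assume a: "v \<in> V" "u \<in> set (around v)"
  obtain p t where t: "(p, t) \<in> subs" "root t = v" using subs_root a by blast
  have "u = p \<or> (\<exists>c\<in>set (kids t). u = root c)" using a(2) around_root[OF t(1)] t(2) by auto
  then show ?thesis
  proof
    assume u: "u = p"
    from t(1) show ?thesis
    proof (cases rule: subs_cases)
      case 1
      then show ?thesis using u t around_root[OF subs_B] root_V[OF subs_B] by simp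
    next
      case 2
      then show ?thesis using u t around_root[OF subs_A] root_V[OF subs_A] by simp
    next
      case (3 q s)
      then show ?thesis using u t around_root[OF 3(1)] root_V[OF 3(1)] by auto
    qed
  next
    assume "\<exists>c\<in>set (kids t). u = root c"
    then obtain c where c: "c \<in> set (kids t)" "u = root c" by blast
    then have "(v, c) \<in> subs" using subs_kid[OF t(1)] t(2) by blast
    then show ?thesis using around_root root_V c(2) by auto
  qed
qed

lemma around_distinct:
  assumes "v \<in> V"
  shows "distinct (around v)" "v \<notin> set (around v)"
proof -
  obtain p t where t: "(p, t) \<in> subs" "root t = v" using subs_root assms by blast
  have "root B \<notin> set_rtree A" "root A \<notin> set_rtree B"
    using disj root_in_set by (metis disjoint_iff)+
  then have d: "distinct (labels t)" "p \<notin> set_rtree t"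
    using t(1) subtrees_distinct[of p t _ A] subtrees_distinct[of p t _ B] dA dB
    unfolding subs_def by auto
  have "set_rtree c \<subseteq> set_rtree t" if "c \<in> set (kids t)" for c
    using that by (cases t) auto
  then have "p \<notin> root ` set (kids t)" using d(2) root_in_set by (metis imageE subsetD)
  then show "distinct (around v)"
    using distinct_map_root_kids[OF d(1)] around_root[OF t(1)] t(2) by simp
  have "root c \<noteq> v" if "c \<in> set (kids t)" for c
    using distinct_labels_kids(2)[OF d(1) that] t(2) root_in_set[of c] by metis
  then have "v \<notin> root ` set (kids t)" by blast
  moreover have "v \<noteq> p" using d(2) t(2) by auto
  ultimately show "v \<notin> set (around v)" using around_root[OF t(1)] t(2) by simp
qed

lemma subs_good: "(p, t) \<in> subs \<Longrightarrow> good (map_rtree r t) \<and> r p * r (root t) < 0"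
  using subtrees_good[of p t _ _ r] good_A good_B root_A root_B unfolding subs_def
  by (auto simp: mult_pos_neg mult_neg_pos)

lemma edges_glued: "{v, u} \<in> edges glued \<longleftrightarrow> v \<in> V \<and> u \<in> set (around v)"
proof
  assume "{v, u} \<in> edges glued"
  then obtain x y where "{v, u} = {x, y}" "x \<in> V" "y \<in> set (around x)" by (auto simp: glued_def)
  then show "v \<in> V \<and> u \<in> set (around v)" using around_sym[of x y] by (auto simp: doubleton_eq_iff)
qed (auto simp: glued_def)

lemma nbrs_glued: "v \<in> V \<Longrightarrow> nbrs glued v = set (around v)"
  by (auto simp: nbrs_def edges_glued)

lemma edges_glued_subs: "e \<in> edges glued \<Longrightarrow> \<exists>p t. (p, t) \<in> subs \<and> e = {p, root t}"
proof -
  assume "e \<in> edges glued"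
  then obtain v u where e: "e = {v, u}" "v \<in> V" "u \<in> set (around v)" by (auto simp: glued_def)
  obtain p t where t: "(p, t) \<in> subs" "root t = v" using subs_root e by blast
  then consider "u = p" | c where "c \<in> set (kids t)" "u = root c"
    using e(3) around_root[OF t(1)] by auto
  then show ?thesis
  proof cases
    case 1
    then have "e = {p, root t}" using e t by auto
    then show ?thesis using t by blast
  next
    case (2 c)
    then show ?thesis using e t subs_kid[OF t(1) 2(1)] by blast
  qed
qed

lemma subs_edge: "(p, t) \<in> subs \<Longrightarrow> {p, root t} \<in> edges glued"
  using edges_glued[of "root t" p] around_root root_V by (simp add: insert_commute)

text \<open>An edge is named by its lower end. Only the edge between the roots of \<open>A\<close>
  and \<open>B\<close> is named twice, and there \<open>total\<close> makes the two sums
  opposite.\<close>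

lemma eweight_glued: "(p, t) \<in> subs \<Longrightarrow> eweight glued {p, root t} = nat \<bar>tsum (map_rtree r t)\<bar>"
proof -
  assume t: "(p, t) \<in> subs"
  have opp: "\<bar>tsum (map_rtree r t)\<bar> = \<bar>tsum (map_rtree r t')\<bar>"
    if t: "(p, t) \<in> subs" and t': "(p', t') \<in> subs" and x: "p = root t'" "p' = root t" for p t p' t'
  proof -
    have AB: "\<bar>tsum (map_rtree r A)\<bar> = \<bar>tsum (map_rtree r B)\<bar>" using total by linarith
    have kid: "t \<in> set (kids t') \<or> t = A \<and> t' = B \<or> t = B \<and> t' = A"
      if "(root t', t) \<in> subs" "(q, t') \<in> subs" for t t' q
      using that(1)
    proof (cases rule: subs_cases)
      case 1
      then show ?thesis using subs_unique[OF that(2) subs_B] by simp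
    next
      case 2
      then show ?thesis using subs_unique[OF that(2) subs_A] by simp
    next
      case (3 q' s)
      then show ?thesis using subs_unique[OF that(2) 3(1)] by simp
    qed
    \<comment> \<open>Two trees cannot be children of each other, since a child has fewer labels;
      this leaves the pair \<open>A\<close>, \<open>B\<close>.\<close>
    have "t \<in> set (kids t') \<or> t = A \<and> t' = B \<or> t = B \<and> t' = A"
      "t' \<in> set (kids t) \<or> t = A \<and> t' = B \<or> t = B \<and> t' = A"
      using kid[of t' t p'] kid[of t t' p] t t' x by auto
    then show ?thesis using AB size_kid[of t t'] size_kid[of t' t] by auto
  qed
  show ?thesis
    unfolding glued_def wtree.simps
  proof (rule the_equality)
    show "\<exists>p' t'. (p', t') \<in> subs \<and> {p, root t} = {p', root t'} \<and>
      nat \<bar>tsum (map_rtree r t)\<bar> = nat \<bar>tsum (map_rtree r t')\<bar>" using t by blast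
    fix n assume "\<exists>p' t'. (p', t') \<in> subs \<and> {p, root t} = {p', root t'} \<and>
      n = nat \<bar>tsum (map_rtree r t')\<bar>"
    then obtain p' t' where t': "(p', t') \<in> subs" "{p, root t} = {p', root t'}"
      "n = nat \<bar>tsum (map_rtree r t')\<bar>" by blast
    then consider "root t = root t'" | "p = root t'" "p' = root t" by (auto simp: doubleton_eq_iff)
    then show "n = nat \<bar>tsum (map_rtree r t)\<bar>"
    proof cases
      case 1
      then show ?thesis using subs_unique[OF t t'(1)] t'(3) by simp
    next
      case 2
      then show ?thesis using opp[OF t t'(1)] t'(3) by simp
    qed
  qed
qed

lemma cyc_list_glued:
  assumes "v \<in> V"
  shows "cyc_list (rot glued v) (nbrs glued v) (around v)"
proof -
  have d: "distinct (around v)" using around_distinct assms by blast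
  have "rot glued v (around v ! i) = around v ! (Suc i mod length (around v))"
    if "i < length (around v)" for i
    unfolding glued_def wtree.simps
  proof (rule the_equality)
    fix w assume "\<exists>j<length (around v). around v ! j = around v ! i \<and>
      w = around v ! (Suc j mod length (around v))"
    then show "w = around v ! (Suc i mod length (around v))"
      using d that by (metis nth_eq_iff_index_eq)
  qed (use that in blast)
  then show ?thesis using d nbrs_glued[OF assms] by (simp add: cyc_list_def)
qed

lemma glued_sel: "verts glued = V" "white glued v = (r v > 0)" "vweight glued v = nat \<bar>r v\<bar>"
  by (simp_all add: glued_def)

lemma simple_graph_glued: "is_simple_graph glued"
proof -
  have "e \<subseteq> V \<and> card e = 2" if ee: "e \<in> edges glued" for e
  proof -
    obtain v u where e: "e = {v, u}" "v \<in> V" "u \<in> set (around v)" using ee by (auto simp: glued_def)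
    then have "u \<in> V" "u \<noteq> v" using around_sym around_distinct by blast+
    then show ?thesis using e by auto
  qed
  moreover have "finite V" by (auto simp: V_def simp flip: set_labels)
  ultimately show ?thesis by (auto simp: is_simple_graph_def glued_sel)
qed

lemma connected_glued: "is_connected glued"
proof -
  let ?R = "adj glued"
  have sym: "sym ?R" by (auto simp: sym_def adj_def insert_commute)
  have E: "(q, root u) \<in> ?R" if "(q, u) \<in> subs" for q u using subs_edge[OF that] by (simp add: adj_def)
  have "(root A, x) \<in> ?R\<^sup>*" if "x \<in> V" for x
  proof (cases "x \<in> set_rtree A")
    case True
    then show ?thesis using subtrees_connected[of "root B" A ?R x] E by (simp add: subs_def)
  next
    case False
    then have "x \<in> set_rtree B" using that by (simp add: V_def)
    then have "(root B, x) \<in> ?R\<^sup>*" using subtrees_connected[of "root A" B ?R x] E by (simp add: subs_def)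
    then show ?thesis using E[OF subs_B] by (simp add: converse_rtrancl_into_rtrancl)
  qed
  moreover from this have "(x, root A) \<in> ?R\<^sup>*" if "x \<in> V" for x
    using that sym_rtrancl[OF sym] by (meson symD)
  moreover have "V \<noteq> {}" unfolding V_def using root_in_set[of A] by blast
  ultimately show ?thesis unfolding is_connected_def glued_sel by (meson rtrancl_trans)
qed

text \<open>Rank a vertex by the size of the subtree it heads. Children rank strictly lower, so a
  neighbour that is not lower must be the parent.\<close>

lemma no_cycle_glued: "\<not> is_cycle glued p"
proof (rule no_cycle_if_ranking)
  let ?h = "\<lambda>v. length (labels (snd (node v)))"
  have par: "x = fst (node v)" if "{v, x} \<in> edges glued" "?h v \<le> ?h x" for v x
  proof -
    have v: "v \<in> V" "x \<in> set (around v)" using that by (auto simp: edges_glued)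
    obtain p t where t: "(p, t) \<in> subs" "root t = v" using subs_root v by blast
    have "x \<noteq> root c" if "c \<in> set (kids t)" for c
      using node_root[OF subs_kid[OF t(1) that]] node_root[OF t(1)] size_kid[OF that] t(2) \<open>?h v \<le> ?h x\<close>
      by auto
    then show ?thesis using v(2) around_root[OF t(1)] node_root[OF t(1)] t(2) by auto
  qed
  show "u = w" if "{v, u} \<in> edges glued" "{v, w} \<in> edges glued" "?h v \<le> ?h u" "?h v \<le> ?h w" for v u w
    using par[OF that(1,3)] par[OF that(2,4)] by simp
qed

lemma is_wtree_glued: "is_wtree glued"
  unfolding is_wtree_def
proof (intro conjI ballI)
  show "is_plane_tree glued"
    unfolding is_plane_tree_def is_tree_def
    using simple_graph_glued connected_glued no_cycle_glued cyc_list_cyclic_on[OF cyc_list_glued]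
    by (auto simp: glued_sel around_def)
  have opp: "r p * r (root t) < 0" if "(p, t) \<in> subs" for p t using subs_good[OF that] by simp
  show "properly_colored glued"
    unfolding properly_colored_def glued_sel
  proof (intro allI impI)
    fix u v assume "{u, v} \<in> edges glued"
    then obtain p t where t: "(p, t) \<in> subs" "{u, v} = {p, root t}" using edges_glued_subs by blast
    then show "(r u > 0) \<noteq> (r v > 0)"
      using opp[OF t(1)] by (auto simp: doubleton_eq_iff mult_less_0_iff)
  qed
  fix v assume "v \<in> verts glued"
  then have v: "v \<in> V" by (simp add: glued_sel)
  then obtain p t where t: "(p, t) \<in> subs" "root t = v" using subs_root by blast
  then have rv: "r v \<noteq> 0" using opp[OF t(1)] by auto
  then show "0 < vweight glued v" by (simp add: glued_sel)
  have kid: "r (root c) * r v < 0 \<and> good (map_rtree r c)" if "c \<in> set (kids t)" for c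
    using subs_good[OF subs_kid[OF t(1) that]] t(2) by (simp add: mult.commute)
  have gt: "good (map_rtree r t)" using subs_good[OF t(1)] by simp
  obtain ts where tt: "t = Node v ts" using t(2) by (cases t) simp
  let ?S = "\<lambda>c. tsum (map_rtree r c)"
  have ew: "eweight glued {v, p} = nat \<bar>?S t\<bar>" using eweight_glued[OF t(1)] t(2) by (simp add: insert_commute)
  have ewk: "eweight glued {v, root c} = nat \<bar>?S c\<bar>" if "c \<in> set ts" for c
    using eweight_glued[OF subs_kid[OF t(1)]] that t(2) unfolding tt by simp
  have St: "?S t = r v + (\<Sum>c\<leftarrow>ts. ?S c)" unfolding tt by (simp add: tsum_Node comp_def)
  \<comment> \<open>\<open>?S t\<close> has the sign of \<open>r v\<close> and the children's sums
    have the opposite one, so \<open>St\<close> becomes an identity between absolute values.\<close>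
  have "\<bar>r v\<bar> = \<bar>?S t\<bar> + (\<Sum>c\<leftarrow>ts. \<bar>?S c\<bar>)"
  proof (cases "r v > 0")
    case True
    have "?S c < 0" if "c \<in> set ts" for c
      using good_tsum_neg[of "map_rtree r c"] kid[of c] that True tt by (simp add: mult_less_0_iff)
    then have "(\<Sum>c\<leftarrow>ts. \<bar>?S c\<bar>) = (\<Sum>c\<leftarrow>ts. - ?S c)"
      by (intro arg_cong[where f = sum_list] map_cong) force+
    moreover have "?S t > 0" using good_tsum_pos[OF gt] True t(2) by simp
    moreover have "(\<Sum>c\<leftarrow>ts. - ?S c) = - (\<Sum>c\<leftarrow>ts. ?S c)" by (induction ts) auto
    ultimately show ?thesis using True St by simp
  next
    case False
    then have neg: "r v < 0" using rv by simp
    have "?S c > 0" if "c \<in> set ts" for c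
      using good_tsum_pos[of "map_rtree r c"] kid[of c] that neg tt by (simp add: mult_less_0_iff)
    then have "(\<Sum>c\<leftarrow>ts. \<bar>?S c\<bar>) = (\<Sum>c\<leftarrow>ts. ?S c)"
      by (intro arg_cong[where f = sum_list] map_cong) force+
    moreover have "?S t < 0" using good_tsum_neg[OF gt] neg t(2) by simp
    ultimately show ?thesis using neg St by simp
  qed
  moreover have "int (\<Sum>c\<leftarrow>ts. nat \<bar>?S c\<bar>) = (\<Sum>c\<leftarrow>ts. \<bar>?S c\<bar>)" by (induction ts) auto
  ultimately have "nat \<bar>r v\<bar> = nat \<bar>?S t\<bar> + (\<Sum>c\<leftarrow>ts. nat \<bar>?S c\<bar>)" by linarith
  moreover have "(\<Sum>c\<leftarrow>ts. eweight glued {v, root c}) = (\<Sum>c\<leftarrow>ts. nat \<bar>?S c\<bar>)"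
    using ewk by (intro arg_cong[where f = sum_list] map_cong) auto
  moreover have "(\<Sum>e\<in>incident glued v. eweight glued e) = (\<Sum>u\<leftarrow>around v. eweight glued {v, u})"
    using sum_incident[OF simple_graph_glued around_distinct(1)[OF v]] nbrs_glued[OF v] by simp
  moreover have "around v = p # map root ts" using around_root[OF t(1)] t(2) tt by simp
  ultimately show "vweight glued v = (\<Sum>e\<in>incident glued v. eweight glued e)"
    using ew by (simp add: glued_sel comp_def)
next
  fix e assume "e \<in> edges glued"
  then obtain p t where t: "(p, t) \<in> subs" "e = {p, root t}" using edges_glued_subs by blast
  have "tsum (map_rtree r t) \<noteq> 0" using subs_good[OF t(1)] by (cases t) auto
  then show "0 < eweight glued e" using eweight_glued[OF t(1)] t(2) by simp
qed

lemma unfoldings_glued: "(A, B) \<in> unfoldings glued"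
proof -
  have "cyc_list (rot glued (root t)) (nbrs glued (root t)) (p # map root (kids t))"
    if "(p, t) \<in> subs" for p t
    using cyc_list_glued[OF root_V[OF that]] around_root[OF that] by simp
  then show ?thesis
    using unfolds_if_subtrees[of "root B" A glued] unfolds_if_subtrees[of "root A" B glued] root_A
    by (simp add: unfoldings_def subs_def glued_sel)
qed

lemma signed_weight_glued: "signed_weight glued v = r v"
  by (auto simp: signed_weight_def glued_sel)

end

lemma good_pairs_realized:
  assumes q: "q \<in> good_pairs V" and V: "\<Sum>V = 0"
  obtains T where "is_wtree T" "q \<in> shapes T" "bij_betw (signed_weight T) (verts T) V"
proof -
  obtain A B where AB: "q = (A, B)" by (cases q)
  have g: "good A" "root A > 0" "good B" "root B < 0" "distinct (labels A @ labels B)"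
    "set_rtree A \<union> set_rtree B = V"
    using q by (auto simp: AB good_pairs_def)
  \<comment> \<open>Vertices are natural numbers, so each signed weight is encoded and serves as the
    name of its own vertex.\<close>
  let ?f = "map_rtree int_encode"
  have id: "map_rtree int_decode (?f t) = t" for t :: "int rtree"
    by (simp add: rtree.map_comp comp_def rtree.map_ident)
  \<comment> \<open>\<open>good_pairs\<close> does not state that the two sums cancel; it follows
    because the labels exhaust \<open>V\<close>.\<close>
  have "tsum A + tsum B = sum_list (labels A @ labels B)" by (simp add: tsum_def)
  also have "\<dots> = \<Sum>V" using distinct_sum_list_conv_Sum[OF g(5)] g(6) by simp
  finally have tot: "tsum A + tsum B = 0" using V by simp
  interpret edge_rooted int_decode "?f A" "?f B"
    using g tot by unfold_locales
      (auto simp: id labels_map distinct_map inj_on_def image_iff dest: inj_onD[OF inj_int_encode])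
  have "map_prod (map_rtree (signed_weight glued)) (map_rtree (signed_weight glued)) (?f A, ?f B) = q"
    by (simp add: signed_weight_glued[abs_def] id AB)
  then have "q \<in> shapes glued" unfolding shapes_def using unfoldings_glued by (metis imageI)
  moreover have "bij_betw (signed_weight glued) (verts glued) V"
  proof -
    have "verts glued = int_encode ` V" using g(6) by (auto simp: glued_sel V_def rtree.set_map)
    then show ?thesis
      by (auto simp: signed_weight_glued[abs_def] bij_betw_def image_image inj_on_def)
  qed
  ultimately show ?thesis using that is_wtree_glued by blast
qed

subsection \<open>The count\<close>

lemma card_quotient_kernel:
  assumes "R = {(x, y). x \<in> A \<and> y \<in> A \<and> f x = f y}"
  shows "card (A // R) = card (f ` A)"
proof -
  have c: "R `` {x} = {y \<in> A. f y = f x}" if "x \<in> A" for x using that by (auto simp: assms)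
  have "bij_betw (\<lambda>z. {y \<in> A. f y = z}) (f ` A) (A // R)"
    unfolding bij_betw_def
  proof
    show "inj_on (\<lambda>z. {y \<in> A. f y = z}) (f ` A)" by (rule inj_onI) blast
    show "(\<lambda>z. {y \<in> A. f y = z}) ` f ` A = A // R"
      by (auto simp: quotient_def c image_image)
  qed
  then show ?thesis by (simp add: bij_betw_same_card)
qed

lemma image_mset_eq_mset_set:
  assumes "finite X" "finite Y" "image_mset f (mset_set X) = mset_set Y"
  shows "bij_betw f X Y"
proof -
  have "f ` X = Y" using arg_cong[OF assms(3), of set_mset] assms(1,2) by simp
  moreover have "card X = card Y" using arg_cong[OF assms(3), of size] by simp
  ultimately show ?thesis using assms(1) by (simp add: bij_betw_def eq_card_imp_inj_on)
qed

text \<open>Weights of one colour are pairwise distinct, so the prescribed multisets are sets, and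
  matching them means that the weights are bijections onto them. Positivity keeps the two colours
  apart once signs are attached.\<close>

lemma wtrees_with_iff:
  assumes k: "inj_on k {1..s}" "\<forall>i \<in> {1..s}. k i > 0" and l: "inj_on l {1..t}" "\<forall>j \<in> {1..t}. l j > 0"
  defines "V \<equiv> (\<lambda>i. int (k i)) ` {1..s} \<union> (\<lambda>j. - int (l j)) ` {1..t}"
  shows "T \<in> wtrees_with s k t l \<longleftrightarrow> is_wtree T \<and> bij_betw (signed_weight T) (verts T) V"
proof -
  let ?W = "{v \<in> verts T. white T v}" and ?B = "{v \<in> verts T. \<not> white T v}"
  have mk: "image_mset k (mset_set {1..s}) = mset_set (k ` {1..s})"
    and ml: "image_mset l (mset_set {1..t}) = mset_set (l ` {1..t})"
    using k(1) l(1) by (simp_all add: image_mset_mset_set)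
  have "(image_mset (vweight T) (mset_set ?W) = mset_set (k ` {1..s}) \<and>
      image_mset (vweight T) (mset_set ?B) = mset_set (l ` {1..t})) \<longleftrightarrow>
      bij_betw (signed_weight T) (verts T) V" if T: "is_wtree T"
  proof -
    note D = is_wtreeD[OF T]
    have fin: "finite (verts T)" using D(4) by (simp add: is_simple_graph_def)
    have U: "verts T = ?W \<union> ?B" by auto
    show ?thesis
    proof
      assume "image_mset (vweight T) (mset_set ?W) = mset_set (k ` {1..s}) \<and>
        image_mset (vweight T) (mset_set ?B) = mset_set (l ` {1..t})"
      then have bW: "bij_betw (vweight T) ?W (k ` {1..s})" and bB: "bij_betw (vweight T) ?B (l ` {1..t})"
        using fin by (auto intro!: image_mset_eq_mset_set)
      have "bij_betw (signed_weight T) ?W ((\<lambda>i. int (k i)) ` {1..s})"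
      proof -
        have "bij_betw (int \<circ> vweight T) ?W (int ` k ` {1..s})"
          by (rule bij_betw_trans[OF bW]) (auto simp: bij_betw_def)
        then show ?thesis
          unfolding image_image by (rule bij_betw_cong[THEN iffD1, rotated]) (simp add: signed_weight_def)
      qed
      moreover have "bij_betw (signed_weight T) ?B ((\<lambda>j. - int (l j)) ` {1..t})"
      proof -
        have "bij_betw ((\<lambda>n. - int n) \<circ> vweight T) ?B ((\<lambda>n. - int n) ` l ` {1..t})"
          by (rule bij_betw_trans[OF bB]) (auto simp: bij_betw_def inj_on_def)
        then show ?thesis
          unfolding image_image by (rule bij_betw_cong[THEN iffD1, rotated]) (simp add: signed_weight_def)
      qed
      ultimately have "bij_betw (signed_weight T) (?W \<union> ?B) V"
        unfolding V_def by (rule bij_betw_combine) (use k(2) l(2) in force)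
      then show "bij_betw (signed_weight T) (verts T) V" using U by simp
    next
      assume b: "bij_betw (signed_weight T) (verts T) V"
      have injW: "inj_on (vweight T) ?W" "inj_on (vweight T) ?B"
        using b by (auto simp: bij_betw_def inj_on_def signed_weight_def)
      have im: "signed_weight T ` verts T = V" using b by (simp add: bij_betw_def)
      have "vweight T ` ?W = k ` {1..s}"
      proof
        show "vweight T ` ?W \<subseteq> k ` {1..s}"
        proof
          fix x assume "x \<in> vweight T ` ?W"
          then obtain v where v: "v \<in> verts T" "white T v" "x = vweight T v" by auto
          then have "int x \<in> V" using im by (force simp: signed_weight_def)
          then show "x \<in> k ` {1..s}" using l(2) by (auto simp: V_def)
        qed
        show "k ` {1..s} \<subseteq> vweight T ` ?W"
        proof
          fix x assume x: "x \<in> k ` {1..s}"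
          then have "int x \<in> V" by (auto simp: V_def)
          then obtain v where v: "v \<in> verts T" "signed_weight T v = int x" using im by (metis imageE)
          then have "white T v \<and> vweight T v = x" using k(2) x by (auto simp: signed_weight_def split: if_splits)
          then show "x \<in> vweight T ` ?W" using v by blast
        qed
      qed
      moreover have "vweight T ` ?B = l ` {1..t}"
      proof
        show "vweight T ` ?B \<subseteq> l ` {1..t}"
        proof
          fix x assume "x \<in> vweight T ` ?B"
          then obtain v where v: "v \<in> verts T" "\<not> white T v" "x = vweight T v" by auto
          then have "- int x \<in> V" "x > 0" using im D(5) by (force simp: signed_weight_def)+
          then show "x \<in> l ` {1..t}" by (auto simp: V_def)
        qed
        show "l ` {1..t} \<subseteq> vweight T ` ?B"
        proof
          fix x assume x: "x \<in> l ` {1..t}"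
          then have "- int x \<in> V" by (auto simp: V_def)
          then obtain v where v: "v \<in> verts T" "signed_weight T v = - int x" using im by (metis imageE)
          then have "\<not> white T v \<and> vweight T v = x" using l(2) x by (auto simp: signed_weight_def split: if_splits)
          then show "x \<in> vweight T ` ?B" using v by blast
        qed
      qed
      ultimately show "image_mset (vweight T) (mset_set ?W) = mset_set (k ` {1..s}) \<and>
        image_mset (vweight T) (mset_set ?B) = mset_set (l ` {1..t})"
        using injW by (simp add: image_mset_mset_set)
    qed
  qed
  then show ?thesis unfolding wtrees_with_def mk ml by blast
qed

text \<open>A subset of \<open>V\<close> is a pair \<open>I\<close>, \<open>J\<close> of index sets.
  If the sums agree, positivity of the weights forces \<open>I\<close> and \<open>J\<close> to be
  empty together, and likewise their complements, so both are nonempty and proper as decomposability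
  demands.\<close>

lemma nonresonant_type:
  assumes k: "inj_on k {1..s}" "\<forall>i \<in> {1..s}. k i > 0" and l: "inj_on l {1..t}" "\<forall>j \<in> {1..t}. l j > 0"
    and sum: "(\<Sum>i = 1..s. k i) = (\<Sum>j = 1..t. l j)" and nd: "\<not> decomposable_type s k t l"
  defines "V \<equiv> (\<lambda>i. int (k i)) ` {1..s} \<union> (\<lambda>j. - int (l j)) ` {1..t}"
  shows "nonresonant V" "card V = s + t"
proof -
  let ?K = "\<lambda>i. int (k i)" and ?L = "\<lambda>j. - int (l j)"
  have iK: "inj_on ?K {1..s}" and iL: "inj_on ?L {1..t}" 
    using k(1) l(1) unfolding inj_on_def by (metis neg_equal_iff_equal of_nat_eq_iff)+
  have d: "?K ` {1..s} \<inter> ?L ` {1..t} = {}"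
  proof (rule equals0I, elim IntE imageE)
    fix x i j assume x: "i \<in> {1..s}" "x = ?K i" "x = ?L j"
    have "k i > 0" using k(2) x(1) by blast
    then show False using x(2,3) by linarith
  qed
  show "card V = s + t" unfolding V_def using d iK iL by (simp add: card_Un_disjoint card_image)
  have S: "\<Sum>(?K ` I \<union> ?L ` J) = int (\<Sum>i\<in>I. k i) - int (\<Sum>j\<in>J. l j)"
    if "I \<subseteq> {1..s}" "J \<subseteq> {1..t}" for I J
  proof -
    have "finite I" "finite J" using that by (auto intro: finite_subset)
    moreover have "?K ` I \<inter> ?L ` J = {}" using d that by blast
    moreover have "inj_on ?K I" "inj_on ?L J" using iK iL that by (auto intro: inj_on_subset)
    ultimately show ?thesis
      by (subst sum.union_disjoint) (auto simp: sum.reindex sum_negf)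
  qed
  show "nonresonant V"
    unfolding nonresonant_def
  proof (intro conjI allI impI)
    show "finite V" by (simp add: V_def)
    show "\<Sum>V = 0" unfolding V_def using S[OF order_refl order_refl] sum by linarith
    fix U assume U: "U \<subset> V" "U \<noteq> {}"
    define I where "I = {i \<in> {1..s}. ?K i \<in> U}"
    define J where "J = {j \<in> {1..t}. ?L j \<in> U}"
    have IJ: "I \<subseteq> {1..s}" "J \<subseteq> {1..t}" by (auto simp: I_def J_def)
    have UIJ: "U = ?K ` I \<union> ?L ` J" using U(1) by (auto simp: I_def J_def V_def)
    have proper: "I \<noteq> {1..s} \<or> J \<noteq> {1..t}" using U(1) UIJ V_def by blast
    have ne: "I \<noteq> {} \<or> J \<noteq> {}" using U(2) UIJ by blast
    have fin: "finite I" "finite J" using IJ by (auto intro: finite_subset)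
    have posI: "(\<Sum>i\<in>I'. k i) > 0" if "I' \<subseteq> {1..s}" "I' \<noteq> {}" for I'
      using that k(2) by (intro sum_pos) (blast intro: finite_subset)+
    have posJ: "(\<Sum>j\<in>J'. l j) > 0" if "J' \<subseteq> {1..t}" "J' \<noteq> {}" for J'
      using that l(2) by (intro sum_pos) (blast intro: finite_subset)+
    have dI: "(\<Sum>i=1..s. k i) = (\<Sum>i\<in>I. k i) + (\<Sum>i\<in>{1..s}-I. k i)"
      using IJ(1) by (metis add.commute finite_atLeastAtMost sum.subset_diff)
    have dJ: "(\<Sum>j=1..t. l j) = (\<Sum>j\<in>J. l j) + (\<Sum>j\<in>{1..t}-J. l j)"
      using IJ(2) by (metis add.commute finite_atLeastAtMost sum.subset_diff)
    have "(\<Sum>i\<in>I. k i) \<noteq> (\<Sum>j\<in>J. l j)"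
    proof
      assume eq: "(\<Sum>i\<in>I. k i) = (\<Sum>j\<in>J. l j)"
      then have "I \<noteq> {}" "J \<noteq> {}" using ne posI[OF IJ(1)] posJ[OF IJ(2)] by force+
      moreover have "(\<Sum>i\<in>{1..s}-I. k i) = (\<Sum>j\<in>{1..t}-J. l j)" using eq dI dJ sum by linarith
      then have "I \<noteq> {1..s}" "J \<noteq> {1..t}"
        using proper posI[of "{1..s} - I"] posJ[of "{1..t} - J"] IJ by force+
      ultimately show False using nd eq IJ unfolding decomposable_type_def by (metis psubsetI)
    qed
    then show "\<Sum>U \<noteq> 0" unfolding UIJ S[OF IJ] by linarith
  qed
qed

theorem theorem2:
  fixes s t :: nat and k l :: "nat \<Rightarrow> nat"
  assumes "s \<ge> 1" and "t \<ge> 1"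
    and "\<forall>i \<in> {1..s}. k i > 0" and "\<forall>j \<in> {1..t}. l j > 0"
    and "(\<Sum>i = 1..s. k i) = (\<Sum>j = 1..t. l j)"
    and "simple_type s k t l"
    and "\<not> decomposable_type s k t l"
  shows "card (wtype s k t l) = fact (s + t - 2)"
proof -
  define V where "V = (\<lambda>i. int (k i)) ` {1..s} \<union> (\<lambda>j. - int (l j)) ` {1..t}"
  have inj: "inj_on k {1..s}" "inj_on l {1..t}" using assms(6) by (auto simp: simple_type_def)
  have V: "nonresonant V" and cV: "card V = s + t"
    unfolding V_def using nonresonant_type[OF inj(1) assms(3) inj(2) assms(4,5,7)] by auto
  let ?W = "wtrees_with s k t l"
  have W: "T \<in> ?W \<longleftrightarrow> is_wtree T \<and> bij_betw (signed_weight T) (verts T) V" for T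
    unfolding V_def by (rule wtrees_with_iff[OF inj(1) assms(3) inj(2) assms(4)])
  have shapeW: "shapes T \<subseteq> good_pairs V" "card (shapes T) = s + t - 1" if "T \<in> ?W" for T
  proof -
    have T: "is_wtree T" "inj_on (signed_weight T) (verts T)" "signed_weight T ` verts T = V"
      using that by (auto simp: W bij_betw_def)
    have "card (verts T) = s + t" using T cV card_image by metis
    then show "shapes T \<subseteq> good_pairs V" "card (shapes T) = s + t - 1"
      using shapes_good_pairs[OF T(1,2)] card_shapes[OF T(1,2)] T(3) assms(1,2) by auto
  qed
  have iso: "isotopic T T'" if "T \<in> ?W" "T' \<in> ?W" "q \<in> shapes T" "q \<in> shapes T'" for T T' q
    using isotopic_if_common_shape that W by blast
  have iso_eq: "isotopic T T' \<longleftrightarrow> shapes T = shapes T'" if TT: "T \<in> ?W" "T' \<in> ?W" for T T'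
  proof
    assume i: "isotopic T T'"
    have w: "is_wtree T" "is_wtree T'" using TT W by auto
    show "shapes T = shapes T'"
      using isotopic_shapes_subset w i isotopic_sym[OF w i] by blast
  next
    assume e: "shapes T = shapes T'"
    \<comment> \<open>Since \<open>s + t \<ge> 2\<close> there is an edge, and the shape it yields
      is common to both trees.\<close>
    have "shapes T \<noteq> {}" using shapeW(2)[OF TT(1)] assms(1,2) by auto
    then show "isotopic T T'" using iso[OF TT] e by blast
  qed
  have "isotopy_rel ?W = {(T, T'). T \<in> ?W \<and> T' \<in> ?W \<and> shapes T = shapes T'}"
    unfolding isotopy_rel_def using iso_eq by blast
  then have quot: "card (wtype s k t l) = card (shapes ` ?W)"
    unfolding wtype_def by (rule card_quotient_kernel)
  have union: "\<Union>(shapes ` ?W) = good_pairs V"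
  proof
    show "\<Union>(shapes ` ?W) \<subseteq> good_pairs V" using shapeW(1) by blast
    show "good_pairs V \<subseteq> \<Union>(shapes ` ?W)"
    proof
      fix q assume "q \<in> good_pairs V"
      then obtain T where "is_wtree T" "q \<in> shapes T" "bij_betw (signed_weight T) (verts T) V"
        using good_pairs_realized V unfolding nonresonant_def by blast
      then show "q \<in> \<Union>(shapes ` ?W)" using W by blast
    qed
  qed
  have n: "card (good_pairs V) = fact (s + t - 1)" using card_good_pairs[OF V] cV assms(1,2) by simp
  \<comment> \<open>An infinite set would have \<open>card\<close> 0, but a factorial is not
    0.\<close>
  then have fin: "finite (good_pairs V)" by (metis card.infinite fact_nonzero)
  \<comment> \<open>Double counting: the shape sets of the isotopy classes partition
    \<open>good_pairs V\<close> into blocks of size \<open>s + t - 1\<close>, one element for each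
    edge.\<close>
  have "(s + t - 1) * card (shapes ` ?W) = card (\<Union>(shapes ` ?W))"
  proof (rule card_partition)
    show "finite (\<Union>(shapes ` ?W))" using fin union by simp
    then show "finite (shapes ` ?W)" by (rule finite_UnionD)
    show "card c = s + t - 1" if "c \<in> shapes ` ?W" for c using that shapeW(2) by blast
    show "c \<inter> c' = {}" if "c \<in> shapes ` ?W" "c' \<in> shapes ` ?W" "c \<noteq> c'" for c c'
      using that iso iso_eq by blast
  qed
  also have "\<dots> = fact (s + t - 1)" using union n by simp
  also have "\<dots> = (s + t - 1) * fact (s + t - 2)"
    using assms(1,2) fact_reduce[of "s + t - 1", where 'a = nat] by (simp add: numeral_2_eq_2)
  finally show ?thesis using quot assms(1,2) by simp
qed

end
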